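(* Let $\mathcal{X},\mathcal{Y},\mathcal{Z}$ be Euclidean spaces, let $\emptyset\neq C\subset\mathcal{X}$ be a connected closed embedded submanifold of $\mathcal{X}$, and let $F:=h+g\circ\mathfrak{S}:\mathcal{X}\to\mathbb{R}$ where: $h:\mathcal{X}\to\mathbb{R}$ is continuously differentiable with $\nabla h$ Lipschitz continuous over $C$ with constant $L_{\nabla h}>0$; $\mathfrak{S}:\mathcal{X}\to\mathcal{Z}$ is continuously differentiable; $g:\mathcal{Z}\to\mathbb{R}$ is Lipschitz continuous with constant $L_g>0$ and $\eta$-weakly convex with $\eta>0$; and $\inf_{\bm{x}\in C}F(\bm{x})>-\infty$. Let $\bm{\varphi}:\mathcal{Y}\to\mathcal{X}$ be continuously differentiable with $\bm{\varphi}(\mathcal{Y})=C$. Let $\bm{y}_1\in\mathcal{Y}$, $c\in(0,1)$, and let $(\mu_n)_{n=1}^\infty\subset(0,(2\eta)^{-1}]$ satisfy $\lim_{n\to\infty}\mu_n=0$, $\sum_{n=1}^\infty\mu_n=+\infty$, and $\mu_{n+1}\le\mu_n$ for all $n\in\mathbb{N}$. Put $F_n:=h+{}^{\mu_n}g\circ\mathfrak{S}$. Assume: (A) there are $\varpi_1\ge0$ and $\varpi_2>0$ such that for all $n\in\mathbb{N}$, $\nabla(F_n\circ\bm{\varphi})$ is Lipschitz continuous on $\mathcal{Y}$ with constant $L_n:=\varpi_1+\varpi_2\mu_n^{-1}$; (B) $(\bm{y}_n)_{n=1}^\infty$ is generated by $\bm{y}_{n+1}=\bm{y}_n-\gamma_n\nabla(F_n\circ\bm{\varphi})(\bm{y}_n)$,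 where the stepsizes $\gamma_n>0$ satisfy, for some $\beta>0$ and all $n\in\mathbb{N}$, $\gamma_n\ge\beta L_n^{-1}$ and $$F_n\circ\bm{\varphi}\left(\bm{y}_n-\gamma_n\nabla(F_n\circ\bm{\varphi})(\bm{y}_n)\right)\le F_n\circ\bm{\varphi}(\bm{y}_n)-c\gamma_n\|\nabla(F_n\circ\bm{\varphi})(\bm{y}_n)\|^2.$$ Then the following hold: (a) For any $\underline{k},\overline{k}\in\mathbb{N}$ with $\underline{k}\le\overline{k}$, $$\min_{\underline{k}\le n\le\overline{k}}\|\nabla(F_n\circ\bm{\varphi})(\bm{y}_n)\|\le\sqrt{\frac{\chi}{\sum_{n=\underline{k}}^{\overline{k}}\mu_n}},\qquad \chi:=\frac{\left(F_1\circ\bm{\varphi}(\bm{y}_1)-\inf_{\bm{y}\in\mathcal{Y}}F_1\circ\bm{\varphi}(\bm{y})+L_g^2\mu_1\right)(\varpi_1+\eta\varpi_2)}{c\beta\eta}\in\mathbb{R}_{++}.$$ (b) $\liminf_{n\to\infty}\|\nabla(F_n\circ\bm{\varphi})(\bm{y}_n)\|=0$. (c) Choose a subsequence $(\bm{y}_{m(l)})_{l=1}^\infty$ (with $m:\mathbb{N}\to\mathbb{N}$ monotonically increasing) such that $\lim_{l\to\infty}\|\nabla(F_{m(l)}\circ\bm{\varphi})(\bm{y}_{m(l)})\|=0$. Then every cluster point $\bm{y}^\star\in\mathcal{Y}$ of $(\bm{y}_{m(l)})_{l=1}^\infty$ satisfies $\bm{0}\in\partial_{\rm L}(F\circ\bm{\varphi})(\bm{y}^\star)$.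 Moreover, if $N_C(\bm{\varphi}(\bm{y}^\star))\supset\mathrm{Ker}((\mathrm{D}\bm{\varphi}(\bm{y}^\star))^* )$, then $\bm{0}\in\partial_{\rm L}(F+\iota_C)(\bm{\varphi}(\bm{y}^\star))$. (d) Consider $\mu_n:=\tau n^{-1/\alpha}$ $(n\in\mathbb{N})$ with $\tau\in(0,(2\eta)^{-1}]$ and $\alpha>1$. Then $(\mu_n)$ satisfies the three conditions imposed above on $(\mu_n)$, and, for any $\epsilon\in(0,1)$, the conditions $\|\nabla(F_n\circ\bm{\varphi})(\bm{y}_n)\|<\epsilon$ and $\mu_n<\epsilon$ are jointly achieved at some iteration index $$n\le\left\lceil\left(\chi\tau^{-1}(1-\alpha^{-1})+\tau^{\alpha-1}+2\right)^{\frac{\alpha}{\alpha-1}}\epsilon^{\min\left\{\frac{-2\alpha}{\alpha-1},-\alpha\right\}}\right\rceil,$$ where $\chi$ is as in (a); and such $\bm{y}_n$ is an $\epsilon$-approximate stationary point.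
   Context: A Euclidean space is a finite-dimensional real Hilbert space; $\mathbb{N}=\{1,2,\dots\}$; $\mathbb{R}_{++}$ is the set of positive reals; $\lceil\cdot\rceil$ is the ceiling. $g$ is $\eta$-weakly convex if $g+\frac{\eta}{2}\|\cdot\|^2$ is convex. For $\mu\in(0,\eta^{-1})$ the Moreau envelope is ${}^{\mu}g(\bar{\bm{z}}):=\inf_{\bm{z}\in\mathcal{Z}}\left(g(\bm{z})+\frac{1}{2\mu}\|\bm{z}-\bar{\bm{z}}\|^2\right)$; it is known to be continuously differentiable. $\iota_C(\bm{x})=0$ if $\bm{x}\in C$ and $+\infty$ otherwise. $\epsilon$-approximate stationary point (for minimizing $F\circ\bm{\varphi}$): a point $\hat{\bm{y}}\in\mathcal{Y}$ with $\|\nabla((h+{}^{\mu}g\circ\mathfrak{S})\circ\bm{\varphi})(\hat{\bm{y}})\|\le\epsilon$ for some $\mu\in(0,\epsilon]$. Embedded submanifold: $C\subset\mathcal{X}$ is a $d$-dimensional embedded submanifold if each $\bar{\bm{x}}\in C$ has an open neighborhood $\mathcal{N}_{\bar{\bm{x}}}\subset\mathcal{X}$ and a continuously differentiable $H_{\bar{\bm{x}}}:\mathcal{N}_{\bar{\bm{x}}}\to\mathbb{R}^{\dim(\mathcal{X})-d}$ with $C\cap\mathcal{N}_{\bar{\bm{x}}}=H_{\bar{\bm{x}}}^{-1}(\bm{0})$ and $\mathrm{Rank}(\mathrm{D}H_{\bar{\bm{x}}}(\bar{\bm{x}}))=\dim(\mathcal{X})-d$. Subdifferentials: for $J$ on a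 Euclidean space with values in $\mathbb{R}\cup\{+\infty\}$ and $\bar{\bm{x}}$ with $J(\bar{\bm{x}})<+\infty$, $\partial_{\rm F}J(\bar{\bm{x}}):=\{\bm{v}\mid \liminf_{\bm{x}\to\bar{\bm{x}},\bm{x}\neq\bar{\bm{x}}}\frac{J(\bm{x})-J(\bar{\bm{x}})-\langle\bm{v},\bm{x}-\bar{\bm{x}}\rangle}{\|\bm{x}-\bar{\bm{x}}\|}\ge0\}$, and the limiting subdifferential $\partial_{\rm L}J(\bar{\bm{x}})$ is the set of all $\bm{v}$ for which there exist $\bm{x}_n\to\bar{\bm{x}}$ with $J(\bm{x}_n)\to J(\bar{\bm{x}})$ and $\bm{v}_n\in\partial_{\rm F}J(\bm{x}_n)$ with $\bm{v}_n\to\bm{v}$. Both are empty where $J=+\infty$. The general normal cone is $N_C(\bar{\bm{x}}):=\partial_{\rm L}\iota_C(\bar{\bm{x}})$. "Monotonically increasing" for $m$ means strictly increasing. *)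

theory Defs
  imports "HOL-Analysis.Analysis"
begin

text \<open>
  Euclidean spaces are types of class \<^class>\<open>euclidean_space\<close>. Sequences indexed by
  $1, 2, \dots$ are functions on \<^typ>\<open>nat\<close> whose value at 0 is never constrained.
\<close>

definition gradient :: "('a::real_inner \<Rightarrow> real) \<Rightarrow> 'a \<Rightarrow> 'a" where
  "gradient f x = (THE D. GDERIV f x :> D)"

definition continuously_differentiable_on ::
  "('a::real_normed_vector \<Rightarrow> 'b::real_normed_vector) \<Rightarrow> 'a set \<Rightarrow> bool"
  (infix \<open>continuously'_differentiable'_on\<close> 50) where
  "f continuously_differentiable_on U \<longleftrightarrow>
     (\<exists>f' :: 'a \<Rightarrow> 'a \<Rightarrow>\<^sub>L 'b. continuous_on U f' \<and>
        (\<forall>x\<in>U. (f has_derivative blinfun_apply (f' x)) (at x)))"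

definition weakly_convex :: "real \<Rightarrow> ('a::real_inner \<Rightarrow> real) \<Rightarrow> bool" where
  "weakly_convex \<eta> g \<longleftrightarrow> convex_on UNIV (\<lambda>z. g z + \<eta> / 2 * (norm z)\<^sup>2)"

text \<open>
  A real infimum: it is only meaningful where the function minimised is bounded below, which is
  the case for \<open>\<eta>\<close>-weakly convex \<open>g\<close> and \<open>0 < \<mu> < 1 / \<eta>\<close>.
\<close>
definition moreau_envelope :: "real \<Rightarrow> ('a::real_inner \<Rightarrow> real) \<Rightarrow> 'a \<Rightarrow> real" where
  "moreau_envelope \<mu> g w = (INF z. g z + 1 / (2 * \<mu>) * (norm (z - w))\<^sup>2)"

definition smoothed ::
  "('x \<Rightarrow> real) \<Rightarrow> ('x \<Rightarrow> 'z::real_inner) \<Rightarrow> ('z \<Rightarrow> real) \<Rightarrow> real \<Rightarrow> 'x \<Rightarrow> real" where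
  "smoothed h S g \<mu> x = h x + moreau_envelope \<mu> g (S x)"

text \<open>
  The parameter \<open>\<eta>\<close> is the weak convexity constant of \<open>g\<close>: the Moreau envelope of index \<open>\<mu>\<close> is only
  considered for \<open>\<mu> < 1 / \<eta>\<close>, so this restriction is part of \<open>for some \<mu> in (0, \<epsilon>]\<close>.
\<close>
definition approx_stationary_point ::
  "real \<Rightarrow> ('x \<Rightarrow> real) \<Rightarrow> ('x \<Rightarrow> 'z::real_inner) \<Rightarrow> ('z \<Rightarrow> real) \<Rightarrow> ('y::real_inner \<Rightarrow> 'x)
     \<Rightarrow> real \<Rightarrow> 'y \<Rightarrow> bool" where
  "approx_stationary_point \<eta> h S g \<phi> \<epsilon> y \<longleftrightarrow>
     (\<exists>\<mu>. 0 < \<mu> \<and> \<mu> \<le> \<epsilon> \<and> \<mu> < 1 / \<eta> \<and> norm (gradient (smoothed h S g \<mu> \<circ> \<phi>) y) \<le> \<epsilon>)"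

text \<open>
  The codomain of dimension \<open>DIM('a) - d\<close> of a local defining function is rendered as a subspace \<open>V\<close>
  of the ambient space with that dimension, since it depends on \<open>d\<close> and may be trivial.
\<close>
definition embedded_submanifold :: "nat \<Rightarrow> 'a::euclidean_space set \<Rightarrow> bool" where
  "embedded_submanifold d C \<longleftrightarrow> d \<le> DIM('a) \<and>
     (\<forall>x\<in>C. \<exists>N (V :: 'a set) (H :: 'a \<Rightarrow> 'a).
        open N \<and> x \<in> N \<and>
        subspace V \<and> dim V = DIM('a) - d \<and> H ` N \<subseteq> V \<and>
        H continuously_differentiable_on N \<and>
        C \<inter> N = {z \<in> N. H z = 0} \<and>
        dim (range (frechet_derivative H (at x))) = DIM('a) - d)"

text \<open>
  In the following, \<open>J\<close> is meant to have values in the reals and $+\infty$; its type also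
  contains $-\infty$.
\<close>
definition frechet_subdiff :: "('a::real_inner \<Rightarrow> ereal) \<Rightarrow> 'a \<Rightarrow> 'a set" where
  "frechet_subdiff J xb =
     {v. J xb < \<infinity> \<and>
         0 \<le> Liminf (at xb) (\<lambda>x. (J x - J xb - ereal (v \<bullet> (x - xb))) / ereal (norm (x - xb)))}"

definition limiting_subdiff :: "('a::real_inner \<Rightarrow> ereal) \<Rightarrow> 'a \<Rightarrow> 'a set" where
  "limiting_subdiff J xb =
     {v. J xb < \<infinity> \<and>
         (\<exists>X V. X \<longlonglongrightarrow> xb \<and> (\<lambda>n. J (X n)) \<longlonglongrightarrow> J xb \<and>
                (\<forall>n. V n \<in> frechet_subdiff J (X n)) \<and> V \<longlonglongrightarrow> v)}"

definition indicator_fun :: "'a set \<Rightarrow> 'a \<Rightarrow> ereal" where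
  "indicator_fun C x = (if x \<in> C then 0 else \<infinity>)"

definition normal_cone :: "'a::real_inner set \<Rightarrow> 'a \<Rightarrow> 'a set" where
  "normal_cone C x = limiting_subdiff (indicator_fun C) x"

definition cluster_point :: "(nat \<Rightarrow> 'a::topological_space) \<Rightarrow> 'a \<Rightarrow> bool" where
  "cluster_point X x \<longleftrightarrow> (\<exists>r::nat \<Rightarrow> nat. strict_mono r \<and> (X \<circ> r) \<longlonglongrightarrow> x)"

definition admissible_indices :: "real \<Rightarrow> (nat \<Rightarrow> real) \<Rightarrow> bool" where
  "admissible_indices \<eta> \<mu> \<longleftrightarrow>
     (\<forall>n\<ge>1. 0 < \<mu> n \<and> \<mu> n \<le> 1 / (2 * \<eta>)) \<and>
     \<mu> \<longlonglongrightarrow> 0 \<and>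
     filterlim (\<lambda>N. \<Sum>n=1..N. \<mu> n) at_top sequentially \<and>
     (\<forall>n\<ge>1. \<mu> (Suc n) \<le> \<mu> n)"

end

theory Submission
  imports Defs "HOL-Real_Asymp.Real_Asymp"
begin

text \<open>
  Decreasing the index from \<open>\<mu>'\<close> to \<open>\<mu>\<close> raises the Moreau envelope of an \<open>L\<close>-Lipschitz function by at
  most \<open>L\<^sup>2 (\<mu>' - \<mu>) / 2\<close>. Hence \<open>F\<^sub>n (\<phi> y\<^sub>n) + L\<^sup>2 \<mu>\<^sub>n\<close> decreases by at least \<open>c \<gamma>\<^sub>n\<close> times the squared
  gradient norm, and telescoping bounds \<open>\<Sum> \<mu>\<^sub>n |\<nabla>(F\<^sub>n \<circ> \<phi>) y\<^sub>n|\<^sup>2\<close> by \<open>\<chi>\<close>; this gives (a), (b) and, with an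
  integral-type lower bound for \<open>\<Sum> n\<^sup>-\<^sup>1\<^sup>/\<^sup>\<alpha>\<close>, (d).

  For (c), the gradient of the envelope at \<open>w\<close> is a subgradient, in the weakly convex sense, of \<open>g\<close> at
  the proximal point \<open>p\<close>, has norm at most \<open>L\<close>, and \<open>|w - p| \<le> \<mu> L\<close>. Along a cluster point these
  subgradients converge to a subgradient \<open>v\<close> of \<open>g\<close>, which minorizes \<open>F\<close> by the differentiable function
  \<open>h + v \<bullet> S - \<eta>/2 |S - S x|\<^sup>2\<close> and turns the limiting stationarity into Frechet stationarity. On the
  manifold, the limiting normal cone consists of Frechet normals, which can be added to it.
\<close>

subsection \<open>The Moreau envelope\<close>

lemma lipschitz_lower:
  fixes g :: "'z::real_inner \<Rightarrow> real"
  assumes "L-lipschitz_on UNIV g"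
  shows "g w - L * norm (z - w) \<le> g z"
  using lipschitz_onD[OF assms, of z w] by (auto simp: dist_norm)

lemma lipschitz_moreau_lower:
  fixes g :: "'z::real_inner \<Rightarrow> real"
  assumes "L-lipschitz_on UNIV g" "0 < \<mu>"
  shows "g w - L\<^sup>2 * \<mu> / 2 \<le> g z + 1 / (2 * \<mu>) * (norm (z - w))\<^sup>2"
proof -
  have "1 / (2 * \<mu>) * (norm (z - w))\<^sup>2 - L * norm (z - w) + L\<^sup>2 * \<mu> / 2
      = (norm (z - w) - L * \<mu>)\<^sup>2 / (2 * \<mu>)"
    using assms(2) by (simp add: field_simps power2_eq_square)
  moreover have "\<dots> \<ge> 0"
    using assms(2) by simp
  ultimately show ?thesis
    using lipschitz_lower[OF assms(1), of w z] by linarith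
qed

lemma moreau_envelope_le:
  fixes g :: "'z::real_inner \<Rightarrow> real"
  assumes "L-lipschitz_on UNIV g" "0 < \<mu>"
  shows "moreau_envelope \<mu> g w \<le> g z + 1 / (2 * \<mu>) * (norm (z - w))\<^sup>2"
  unfolding moreau_envelope_def
  by (rule cINF_lower) (use lipschitz_moreau_lower[OF assms] in \<open>auto intro!: bdd_belowI2\<close>)

lemma moreau_envelope_greatest:
  assumes "\<And>z. b \<le> g z + 1 / (2 * \<mu>) * (norm (z - w))\<^sup>2"
  shows "b \<le> moreau_envelope \<mu> g w"
  unfolding moreau_envelope_def by (rule cINF_greatest) (use assms in auto)

lemma moreau_envelope_ge_self:
  fixes g :: "'z::real_inner \<Rightarrow> real"
  assumes "L-lipschitz_on UNIV g" "0 < \<mu>"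
  shows "g w - L\<^sup>2 * \<mu> / 2 \<le> moreau_envelope \<mu> g w"
  by (intro moreau_envelope_greatest lipschitz_moreau_lower assms)

lemma moreau_envelope_antimono:
  fixes g :: "'z::real_inner \<Rightarrow> real"
  assumes "L-lipschitz_on UNIV g" "0 < \<mu>" "\<mu> \<le> \<mu>'"
  shows "moreau_envelope \<mu>' g w \<le> moreau_envelope \<mu> g w"
proof (rule moreau_envelope_greatest)
  fix z
  have "moreau_envelope \<mu>' g w \<le> g z + 1 / (2 * \<mu>') * (norm (z - w))\<^sup>2"
    using assms by (intro moreau_envelope_le) auto
  also have "\<dots> \<le> g z + 1 / (2 * \<mu>) * (norm (z - w))\<^sup>2"
    using assms by (intro add_left_mono mult_right_mono) (auto intro!: divide_left_mono)
  finally show "moreau_envelope \<mu>' g w \<le> g z + 1 / (2 * \<mu>) * (norm (z - w))\<^sup>2" .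
qed

text \<open>
  Comparing a point \<open>z\<close> for the index \<open>\<mu>'\<close> with \<open>w + (\<mu> / \<mu>') (z - w)\<close> for the index \<open>\<mu>\<close> gives a
  bound that telescopes along a decreasing sequence of indices.
\<close>
lemma moreau_envelope_index_diff:
  fixes g :: "'z::real_inner \<Rightarrow> real"
  assumes "L-lipschitz_on UNIV g" "0 < \<mu>" "\<mu> \<le> \<mu>'"
  shows "moreau_envelope \<mu> g w \<le> moreau_envelope \<mu>' g w + L\<^sup>2 * (\<mu>' - \<mu>) / 2"
proof -
  have "moreau_envelope \<mu> g w - L\<^sup>2 * (\<mu>' - \<mu>) / 2 \<le> moreau_envelope \<mu>' g w"
  proof (rule moreau_envelope_greatest)
    fix z
    define t where "t = \<mu> / \<mu>'"
    have t: "0 < t" "t \<le> 1" and \<mu>: "\<mu> = t * \<mu>'" and pos: "0 < \<mu>'"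
      using assms by (auto simp: t_def)
    define D where "D = norm (z - w)"
    define z' where "z' = w + t *\<^sub>R (z - w)"
    have "z' - z = - ((1 - t) *\<^sub>R (z - w))"
      by (simp add: z'_def algebra_simps)
    then have zz: "norm (z' - z) = (1 - t) * D"
      using t by (simp add: D_def)
    have zw: "norm (z' - w) = t * D"
      using t by (simp add: D_def z'_def)
    have "g z' \<le> g z + L * ((1 - t) * D)"
      using lipschitz_lower[OF assms(1), of z' z] zz by (simp add: norm_minus_commute)
    moreover have "moreau_envelope \<mu> g w \<le> g z' + 1 / (2 * \<mu>) * (t * D)\<^sup>2"
      using moreau_envelope_le[OF assms(1,2), of w z'] zw by simp
    moreover have "1 / (2 * \<mu>') * D\<^sup>2 - (L * ((1 - t) * D) + 1 / (2 * \<mu>) * (t * D)\<^sup>2)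
        + L\<^sup>2 * (\<mu>' - \<mu>) / 2 = (1 - t) * (D - L * \<mu>')\<^sup>2 / (2 * \<mu>')"
      using t pos by (simp add: \<mu> field_simps power2_eq_square)
    moreover have "(1 - t) * (D - L * \<mu>')\<^sup>2 / (2 * \<mu>') \<ge> 0"
      using t pos by simp
    ultimately show "moreau_envelope \<mu> g w - L\<^sup>2 * (\<mu>' - \<mu>) / 2
        \<le> g z + 1 / (2 * \<mu>') * (norm (z - w))\<^sup>2"
      unfolding D_def by linarith
  qed
  then show ?thesis by simp
qed

lemma moreau_envelope_attained:
  fixes g :: "'z::euclidean_space \<Rightarrow> real"
  assumes "L-lipschitz_on UNIV g" "0 < \<mu>"
  obtains p where "moreau_envelope \<mu> g w = g p + 1 / (2 * \<mu>) * (norm (p - w))\<^sup>2"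
proof -
  let ?q = "\<lambda>z. g z + 1 / (2 * \<mu>) * (norm (z - w))\<^sup>2"
  have L: "0 \<le> L"
    using assms(1) by (rule lipschitz_on_nonneg)
  have "continuous_on (cball w (2 * \<mu> * L)) ?q"
    by (intro continuous_intros continuous_on_subset[OF lipschitz_on_continuous_on[OF assms(1)]]) auto
  moreover have w: "w \<in> cball w (2 * \<mu> * L)"
    using L assms(2) by simp
  ultimately obtain p where p: "\<forall>z\<in>cball w (2 * \<mu> * L). ?q p \<le> ?q z"
    using continuous_attains_inf[OF compact_cball] by blast
  have "?q p \<le> ?q z" for z
  proof (cases "z \<in> cball w (2 * \<mu> * L)")
    case False
    then have "2 * \<mu> * L < norm (z - w)"
      by (simp add: dist_norm norm_minus_commute)
    then have "2 * \<mu> * L * norm (z - w) \<le> norm (z - w) * norm (z - w)"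
      by (intro mult_right_mono) auto
    then have "L * norm (z - w) \<le> 1 / (2 * \<mu>) * (norm (z - w))\<^sup>2"
      using assms(2) by (simp add: field_simps power2_eq_square)
    then have "?q w \<le> ?q z"
      using lipschitz_lower[OF assms(1), of w z] by simp
    moreover have "?q p \<le> ?q w"
      using p w by blast
    ultimately show ?thesis by linarith
  qed (use p in auto)
  then have "moreau_envelope \<mu> g w = ?q p"
    by (intro antisym moreau_envelope_le[OF assms] moreau_envelope_greatest)
  then show thesis ..
qed

lemma weakly_convex_minimizer_subgradient:
  fixes g :: "'z::real_inner \<Rightarrow> real"
  assumes "weakly_convex \<eta> g" "0 < \<mu>"
    and min: "\<And>z. g p + 1 / (2 * \<mu>) * (norm (p - w))\<^sup>2 \<le> g z + 1 / (2 * \<mu>) * (norm (z - w))\<^sup>2"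
  shows "g p + ((w - p) /\<^sub>R \<mu>) \<bullet> (z - p) - \<eta> / 2 * (norm (z - p))\<^sup>2 \<le> g z"
proof -
  define a where "a = g z - g p - ((w - p) /\<^sub>R \<mu>) \<bullet> (z - p) + \<eta> / 2 * (norm (z - p))\<^sup>2"
  define b where "b = 1 / (2 * \<mu>) * (norm (z - p))\<^sup>2 - \<eta> / 2 * (norm (z - p))\<^sup>2"
  have ab: "0 \<le> a + t * b" if t: "0 < t" "t < 1" for t :: real
  proof -
    define zt where "zt = (1 - t) *\<^sub>R p + t *\<^sub>R z"
    have "g zt + \<eta> / 2 * (norm zt)\<^sup>2
        \<le> (1 - t) * (g p + \<eta> / 2 * (norm p)\<^sup>2) + t * (g z + \<eta> / 2 * (norm z)\<^sup>2)"
      using convex_onD[OF assms(1)[unfolded weakly_convex_def], of t p z] t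
      by (simp add: zt_def)
    moreover have "(norm zt)\<^sup>2
        = (1 - t) * (norm p)\<^sup>2 + t * (norm z)\<^sup>2 - t * (1 - t) * (norm (z - p))\<^sup>2"
      unfolding zt_def power2_norm_eq_inner
      by (simp add: inner_simps inner_commute algebra_simps)
    ultimately have "g zt + \<eta> / 2 * ((1 - t) * (norm p)\<^sup>2 + t * (norm z)\<^sup>2
          - t * (1 - t) * (norm (z - p))\<^sup>2)
        \<le> (1 - t) * (g p + \<eta> / 2 * (norm p)\<^sup>2) + t * (g z + \<eta> / 2 * (norm z)\<^sup>2)"
      by simp
    then have 1: "g zt \<le> (1 - t) * g p + t * g z + \<eta> / 2 * (t * (1 - t) * (norm (z - p))\<^sup>2)"
      by (simp add: algebra_simps add_divide_distrib diff_divide_distrib)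
    have "zt - w = (p - w) + t *\<^sub>R (z - p)"
      by (simp add: zt_def algebra_simps)
    then have 2: "(norm (zt - w))\<^sup>2
        = (norm (p - w))\<^sup>2 + 2 * t * ((p - w) \<bullet> (z - p)) + t\<^sup>2 * (norm (z - p))\<^sup>2"
      by (simp only: power2_norm_eq_inner) (simp add: inner_simps inner_commute algebra_simps
          power2_eq_square)
    have 3: "((w - p) /\<^sub>R \<mu>) \<bullet> (z - p) = - (2 * ((p - w) \<bullet> (z - p)) * (1 / (2 * \<mu>)))"
      using assms(2) by (simp add: field_simps inner_simps)
    have "0 \<le> g zt + 1 / (2 * \<mu>) * (norm (zt - w))\<^sup>2 - (g p + 1 / (2 * \<mu>) * (norm (p - w))\<^sup>2)"
      using min[of zt] by simp
    also have "\<dots> \<le> t * (a + t * b)"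
      unfolding a_def b_def 3 using 1 unfolding 2 by (simp add: algebra_simps power2_eq_square)
    finally show ?thesis
      using t by (simp add: zero_le_mult_iff)
  qed
  have "((\<lambda>t. a + t * b) \<longlongrightarrow> a + 0 * b) (at_right 0)"
    by (intro tendsto_intros)
  moreover have "\<forall>\<^sub>F t in at_right 0. 0 \<le> a + t * b"
    using ab by (auto simp: eventually_at_right_field intro!: exI[of _ 1])
  ultimately have "0 \<le> a + 0 * b"
    by (intro tendsto_lowerbound) auto
  then show ?thesis
    by (simp add: a_def)
qed

lemma lipschitz_subgradient_bound:
  fixes g :: "'z::real_inner \<Rightarrow> real"
  assumes "L-lipschitz_on UNIV g"
    and sub: "\<And>z. g p + u \<bullet> (z - p) - \<kappa> * (norm (z - p))\<^sup>2 \<le> g z"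
  shows "norm u \<le> L"
proof (cases "u = 0")
  case True
  then show ?thesis using lipschitz_on_nonneg[OF assms(1)] by simp
next
  case False
  have ineq: "0 \<le> (L - norm u) + t * (\<kappa> * norm u)" if t: "0 < t" for t :: real
  proof -
    have "g p + u \<bullet> (t *\<^sub>R u) - \<kappa> * (norm (t *\<^sub>R u))\<^sup>2 \<le> g (p + t *\<^sub>R u)"
      using sub[of "p + t *\<^sub>R u"] by simp
    moreover have "g (p + t *\<^sub>R u) \<le> g p + L * norm (t *\<^sub>R u)"
      using lipschitz_lower[OF assms(1), of "p + t *\<^sub>R u" p] by simp
    ultimately have "0 \<le> L * norm (t *\<^sub>R u) - u \<bullet> (t *\<^sub>R u) + \<kappa> * (norm (t *\<^sub>R u))\<^sup>2"
      by linarith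
    also have "\<dots> = (t * norm u) * ((L - norm u) + t * (\<kappa> * norm u))"
      using t by (simp add: power_mult_distrib algebra_simps flip: power2_norm_eq_inner)
        (simp add: power2_eq_square)
    finally show ?thesis
      using t False by (subst (asm) zero_le_mult_iff) (auto simp: mult_le_0_iff)
  qed
  have "((\<lambda>t. (L - norm u) + t * (\<kappa> * norm u)) \<longlongrightarrow> (L - norm u) + 0 * (\<kappa> * norm u)) (at_right 0)"
    by (intro tendsto_intros)
  moreover have "\<forall>\<^sub>F t in at_right 0. 0 \<le> (L - norm u) + t * (\<kappa> * norm u)"
    using ineq by (auto simp: eventually_at_right_field intro!: exI[of _ 1])
  ultimately have "0 \<le> (L - norm u) + 0 * (\<kappa> * norm u)"
    by (intro tendsto_lowerbound) auto
  then show ?thesis by simp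
qed

lemma has_derivative_of_quadratic_bounds:
  fixes f :: "'a::real_inner \<Rightarrow> real"
  assumes "\<And>d. \<bar>f (x + d) - f x - u \<bullet> d\<bar> \<le> K * (norm d)\<^sup>2"
  shows "(f has_derivative (\<lambda>d. u \<bullet> d)) (at x)"
  unfolding has_derivative_at
proof
  show "bounded_linear ((\<bullet>) u)" by (rule bounded_linear_inner_right)
  have lim: "((\<lambda>d::'a. K * norm d) \<longlongrightarrow> 0) (at 0)"
    by (auto intro!: tendsto_eq_intros)
  have "norm (norm (f (x + d) - f x - u \<bullet> d) / norm d) \<le> K * norm d" for d
    using assms[of d] by (cases "d = 0") (simp_all add: divide_le_eq power2_eq_square mult.assoc)
  then show "(\<lambda>d. norm (f (x + d) - f x - u \<bullet> d) / norm d) \<midarrow>0\<rightarrow> 0"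
    by (intro Lim_null_comparison[OF always_eventually lim]) blast
qed

lemma moreau_envelope_prox:
  fixes g :: "'z::euclidean_space \<Rightarrow> real"
  assumes lip: "L-lipschitz_on UNIV g" and wc: "weakly_convex \<eta> g"
    and "0 < \<eta>" and \<mu>: "0 < \<mu>" "\<mu> \<le> 1 / (2 * \<eta>)"
  obtains p u where "w - p = \<mu> *\<^sub>R u" "norm u \<le> L"
    and "\<And>z. g p + u \<bullet> (z - p) - \<eta> / 2 * (norm (z - p))\<^sup>2 \<le> g z"
    and "(moreau_envelope \<mu> g has_derivative (\<lambda>d. u \<bullet> d)) (at w)"
proof -
  obtain p where p: "moreau_envelope \<mu> g w = g p + 1 / (2 * \<mu>) * (norm (p - w))\<^sup>2"
    using moreau_envelope_attained[OF lip \<mu>(1)] .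
  define u where "u = (w - p) /\<^sub>R \<mu>"
  have u: "w - p = \<mu> *\<^sub>R u"
    using \<mu> by (simp add: u_def)
  then have pw: "p - w = - (\<mu> *\<^sub>R u)"
    by (simp add: algebra_simps)
  have sub: "g p + u \<bullet> (z - p) - \<eta> / 2 * (norm (z - p))\<^sup>2 \<le> g z" for z
    unfolding u_def
    by (rule weakly_convex_minimizer_subgradient[OF wc \<mu>(1)])
      (rule moreau_envelope_le[OF lip \<mu>(1), of w, unfolded p])
  have env: "moreau_envelope \<mu> g w = g p + \<mu> / 2 * (norm u)\<^sup>2"
    unfolding p pw using \<mu> by (simp add: power_mult_distrib field_simps power2_eq_square)
  have up: "moreau_envelope \<mu> g (w + d) \<le> moreau_envelope \<mu> g w + u \<bullet> d + 1 / (2 * \<mu>) * (norm d)\<^sup>2"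
    for d
  proof -
    have "p - (w + d) = - (\<mu> *\<^sub>R u + d)"
      using pw by (simp add: algebra_simps)
    then have "(norm (p - (w + d)))\<^sup>2 = \<mu>\<^sup>2 * (norm u)\<^sup>2 + 2 * \<mu> * (u \<bullet> d) + (norm d)\<^sup>2"
      by (simp only: power2_norm_eq_inner)
        (simp add: inner_simps inner_commute algebra_simps power2_eq_square)
    then show ?thesis
      using moreau_envelope_le[OF lip \<mu>(1), of "w + d" p] \<mu>
      by (simp add: env field_simps power2_eq_square)
  qed
  have low: "moreau_envelope \<mu> g w + u \<bullet> d - \<eta> * (norm d)\<^sup>2 \<le> moreau_envelope \<mu> g (w + d)" for d
  proof (rule moreau_envelope_greatest)
    fix z
    define s where "s = z - p"
    have "z - (w + d) = (s - d) - \<mu> *\<^sub>R u"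
      using u by (simp add: s_def algebra_simps)
    then have "(norm (z - (w + d)))\<^sup>2 = (norm (s - d))\<^sup>2 - 2 * \<mu> * (u \<bullet> (s - d)) + \<mu>\<^sup>2 * (norm u)\<^sup>2"
      by (simp only: power2_norm_eq_inner)
        (simp add: inner_simps inner_commute algebra_simps power2_eq_square)
    then have 1: "1 / (2 * \<mu>) * (norm (z - (w + d)))\<^sup>2
        = 1 / (2 * \<mu>) * (norm (s - d))\<^sup>2 - u \<bullet> (s - d) + \<mu> / 2 * (norm u)\<^sup>2"
      using \<mu> by (simp add: field_simps power2_eq_square)
    have "\<eta> \<le> 1 / (2 * \<mu>)"
      using \<mu> \<open>0 < \<eta>\<close> by (simp add: field_simps)
    then have 2: "\<eta> * (norm (s - d))\<^sup>2 \<le> 1 / (2 * \<mu>) * (norm (s - d))\<^sup>2"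
      by (intro mult_right_mono) auto
    have "(norm s)\<^sup>2 \<le> 2 * (norm (s - d))\<^sup>2 + 2 * (norm d)\<^sup>2"
    proof -
      have "2 * (norm (s - d))\<^sup>2 + 2 * (norm d)\<^sup>2 - (norm s)\<^sup>2 = (norm (s - 2 *\<^sub>R d))\<^sup>2"
        by (simp only: power2_norm_eq_inner) (simp add: inner_simps inner_commute algebra_simps)
      then show ?thesis
        by (smt (verit) zero_le_power2)
    qed
    then have "\<eta> / 2 * (norm s)\<^sup>2 \<le> \<eta> / 2 * (2 * (norm (s - d))\<^sup>2 + 2 * (norm d)\<^sup>2)"
      using \<open>0 < \<eta>\<close> by (intro mult_left_mono) auto
    then have 3: "\<eta> / 2 * (norm s)\<^sup>2 \<le> \<eta> * (norm (s - d))\<^sup>2 + \<eta> * (norm d)\<^sup>2"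
      by (simp add: algebra_simps)
    show "moreau_envelope \<mu> g w + u \<bullet> d - \<eta> * (norm d)\<^sup>2
        \<le> g z + 1 / (2 * \<mu>) * (norm (z - (w + d)))\<^sup>2"
      using 1 2 3 sub[of z] unfolding env s_def[symmetric] by (simp add: inner_diff_right)
  qed
  have "\<bar>moreau_envelope \<mu> g (w + d) - moreau_envelope \<mu> g w - u \<bullet> d\<bar>
      \<le> (1 / (2 * \<mu>) + \<eta>) * (norm d)\<^sup>2" for d
  proof -
    have "0 \<le> 1 / (2 * \<mu>) * (norm d)\<^sup>2" "0 \<le> \<eta> * (norm d)\<^sup>2"
      using \<mu> \<open>0 < \<eta>\<close> by auto
    then show ?thesis
      unfolding distrib_right using up[of d] low[of d] by linarith
  qed
  then show thesis
    using that[OF u lipschitz_subgradient_bound[OF lip sub] sub] has_derivative_of_quadratic_bounds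
    by blast
qed

subsection \<open>Subdifferentials and normal cones of submanifolds\<close>

lemma frechet_subdiff_add_indicator_iff:
  fixes f :: "'a::real_inner \<Rightarrow> real"
  shows "v \<in> frechet_subdiff (\<lambda>x. ereal (f x) + indicator_fun C x) xb \<longleftrightarrow>
    xb \<in> C \<and> (\<forall>e>0. \<forall>\<^sub>F x in at xb. x \<in> C \<longrightarrow>
      f xb + v \<bullet> (x - xb) - e * norm (x - xb) \<le> f x)"
    (is "?L \<longleftrightarrow> ?R")
proof (cases "xb \<in> C")
  case True
  define q where "q x = (ereal (f x) + indicator_fun C x - (ereal (f xb) + indicator_fun C xb)
      - ereal (v \<bullet> (x - xb))) / ereal (norm (x - xb))" for x
  have q: "q x = (if x \<in> C then ereal ((f x - f xb - v \<bullet> (x - xb)) / norm (x - xb)) else \<infinity>)"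
    if "x \<noteq> xb" for x
    using that True by (auto simp: q_def indicator_fun_def)
  have "?L \<longleftrightarrow> 0 \<le> Liminf (at xb) q"
    using True by (simp add: frechet_subdiff_def q_def[abs_def] indicator_fun_def)
  also have "\<dots> \<longleftrightarrow> (\<forall>e>0. \<forall>\<^sub>F x in at xb. x \<in> C \<longrightarrow>
      f xb + v \<bullet> (x - xb) - e * norm (x - xb) \<le> f x)"
  proof
    assume *: "0 \<le> Liminf (at xb) q"
    show "\<forall>e>0. \<forall>\<^sub>F x in at xb. x \<in> C \<longrightarrow> f xb + v \<bullet> (x - xb) - e * norm (x - xb) \<le> f x"
    proof (intro allI impI)
      fix e :: real assume "e > 0"
      then have "\<forall>\<^sub>F x in at xb. ereal (- e) < q x"
        using * by (simp add: le_Liminf_iff)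
      moreover have "\<forall>\<^sub>F x in at xb. x \<noteq> xb"
        by (simp add: eventually_at_filter)
      ultimately show "\<forall>\<^sub>F x in at xb. x \<in> C \<longrightarrow> f xb + v \<bullet> (x - xb) - e * norm (x - xb) \<le> f x"
        by eventually_elim (auto simp: q less_divide_eq)
    qed
  next
    assume *: "\<forall>e>0. \<forall>\<^sub>F x in at xb. x \<in> C \<longrightarrow>
      f xb + v \<bullet> (x - xb) - e * norm (x - xb) \<le> f x"
    show "0 \<le> Liminf (at xb) q"
      unfolding le_Liminf_iff
    proof (intro allI impI)
      fix y :: ereal assume "y < 0"
      then obtain r where r: "y < ereal r" "ereal r < 0"
        using ereal_dense2 by blast
      then have "\<forall>\<^sub>F x in at xb. x \<in> C \<longrightarrow> f xb + v \<bullet> (x - xb) - (- r) * norm (x - xb) \<le> f x"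
        using *[rule_format, of "- r"] by simp
      moreover have "\<forall>\<^sub>F x in at xb. x \<noteq> xb"
        by (simp add: eventually_at_filter)
      ultimately show "\<forall>\<^sub>F x in at xb. y < q x"
      proof eventually_elim
        case (elim x)
        then have "ereal r \<le> q x"
          by (auto simp: q le_divide_eq)
        then show ?case
          using r(1) by (rule less_le_trans[rotated])
      qed
    qed
  qed
  finally show ?thesis
    using True by simp
qed (simp add: frechet_subdiff_def indicator_fun_def)

lemma frechet_subdiff_real_iff:
  fixes f :: "'a::real_inner \<Rightarrow> real"
  shows "v \<in> frechet_subdiff (\<lambda>x. ereal (f x)) xb \<longleftrightarrow>
    (\<forall>e>0. \<forall>\<^sub>F x in at xb. f xb + v \<bullet> (x - xb) - e * norm (x - xb) \<le> f x)"
  using frechet_subdiff_add_indicator_iff[of v f UNIV xb] by (simp add: indicator_fun_def)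

lemma frechet_subdiff_indicator_iff:
  fixes xb :: "'a::real_inner"
  shows "v \<in> frechet_subdiff (indicator_fun C) xb \<longleftrightarrow>
    xb \<in> C \<and> (\<forall>e>0. \<forall>\<^sub>F x in at xb. x \<in> C \<longrightarrow> v \<bullet> (x - xb) \<le> e * norm (x - xb))"
proof -
  have "indicator_fun C = (\<lambda>x. ereal 0 + indicator_fun C x)"
    by (simp add: indicator_fun_def fun_eq_iff)
  then show ?thesis
    using frechet_subdiff_add_indicator_iff[of v "\<lambda>_. 0" C xb] by (simp add: algebra_simps)
qed

lemma frechet_subdiff_subset_limiting: "frechet_subdiff J x \<subseteq> limiting_subdiff J x"
proof
  fix v assume v: "v \<in> frechet_subdiff J x"
  then have "J x < \<infinity>"
    by (simp add: frechet_subdiff_def)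
  with v show "v \<in> limiting_subdiff J x"
    unfolding limiting_subdiff_def mem_Collect_eq
    by (intro conjI exI[of _ "\<lambda>_. x"] exI[of _ "\<lambda>_. v"]) simp_all
qed

lemma frechet_normal_curve:
  fixes c :: "real \<Rightarrow> 'a::real_inner"
  assumes a: "a \<in> frechet_subdiff (indicator_fun C) x"
    and c: "(c has_derivative (\<lambda>s. s *\<^sub>R t)) (at 0)" "c 0 = x" "\<forall>\<^sub>F s in at 0. c s \<in> C"
  shows "a \<bullet> t \<le> 0"
proof -
  define q where "q s = (c s - x) /\<^sub>R s" for s
  have "((\<lambda>s. norm (c (0 + s) - c 0 - s *\<^sub>R t) / norm s) \<longlongrightarrow> 0) (at 0)"
    using c(1) by (simp add: has_derivative_at)
  moreover have "\<forall>\<^sub>F s in at 0. norm (c (0 + s) - c 0 - s *\<^sub>R t) / norm s = norm (q s - t)"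
  proof (rule eventually_mono[OF eventually_neq_at_within[of 0]])
    fix s :: real assume "s \<noteq> 0"
    then have "q s - t = (c (0 + s) - c 0 - s *\<^sub>R t) /\<^sub>R s"
      by (simp add: q_def c(2) scaleR_diff_right del: scaleR_cancel_left scaleR_cancel_right)
    then show "norm (c (0 + s) - c 0 - s *\<^sub>R t) / norm s = norm (q s - t)"
      by (simp only: norm_scaleR abs_inverse real_norm_def divide_inverse mult.commute)
  qed
  ultimately have "((\<lambda>s. norm (q s - t)) \<longlongrightarrow> 0) (at 0)"
    by (rule Lim_transform_eventually)
  then have "(q \<longlongrightarrow> t) (at 0)"
    by (rule LIM_zero_cancel[OF tendsto_norm_zero_cancel])
  then have lim: "(q \<longlongrightarrow> t) (at_right 0)"
    by (simp add: filterlim_at_split)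
  have "a \<bullet> t \<le> e * norm t" if "e > 0" for e
  proof -
    have "\<forall>\<^sub>F z in at x. z \<in> C \<longrightarrow> a \<bullet> (z - x) \<le> e * norm (z - x)"
      using a that by (simp add: frechet_subdiff_indicator_iff)
    then have "\<forall>\<^sub>F z in nhds x. z \<in> C \<longrightarrow> a \<bullet> (z - x) \<le> e * norm (z - x)"
      unfolding eventually_at_filter by (rule eventually_mono) auto
    moreover have "(c \<longlongrightarrow> x) (at 0)"
      using has_derivative_continuous[OF c(1)] by (simp add: isCont_def c(2))
    ultimately have "\<forall>\<^sub>F s in at 0. c s \<in> C \<longrightarrow> a \<bullet> (c s - x) \<le> e * norm (c s - x)"
      by (rule eventually_compose_filterlim)
    with c(3) have "\<forall>\<^sub>F s in at 0. a \<bullet> (c s - x) \<le> e * norm (c s - x)"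
      by eventually_elim simp
    then have "\<forall>\<^sub>F s in at_right 0. a \<bullet> (c s - x) \<le> e * norm (c s - x)"
      by (simp add: eventually_at_split)
    then have "\<forall>\<^sub>F s in at_right 0. a \<bullet> q s \<le> e * norm (q s)"
      using eventually_at_right_less[of 0]
      by eventually_elim (simp add: q_def mult.left_commute[of e])
    moreover have "((\<lambda>s. a \<bullet> q s) \<longlongrightarrow> a \<bullet> t) (at_right 0)"
        "((\<lambda>s. e * norm (q s)) \<longlongrightarrow> e * norm t) (at_right 0)"
      by (intro tendsto_intros lim)+
    ultimately show ?thesis
      by (intro tendsto_le[of "at_right 0" "\<lambda>s. e * norm (q s)" _ "\<lambda>s. a \<bullet> q s"]) auto
  qed
  then have "\<forall>\<^sub>F e in at_right 0. a \<bullet> t \<le> e * norm t"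
    by (auto simp: eventually_at_right_field intro!: exI[of _ 1])
  moreover have "((\<lambda>e. e * norm t) \<longlongrightarrow> 0 * norm t) (at_right 0)"
    by (intro tendsto_intros)
  ultimately have "a \<bullet> t \<le> 0 * norm t"
    by (intro tendsto_lowerbound[where F = "at_right (0::real)"]) auto
  then show ?thesis by simp
qed

lemma derivative_in_subspace:
  fixes H :: "'a::real_normed_vector \<Rightarrow> 'b::euclidean_space"
  assumes "subspace V" "open N" "x \<in> N" "H ` N \<subseteq> V" "(H has_derivative L) (at x)"
  shows "range L \<subseteq> V"
proof -
  have "v \<bullet> L d = 0" if v: "v \<in> V\<^sup>\<bottom>" for v d
  proof -
    have "((\<lambda>z. v \<bullet> H z) has_derivative (\<lambda>d. v \<bullet> L d)) (at x)"
      by (intro has_derivative_inner_right assms)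
    moreover have "((\<lambda>z. v \<bullet> H z) has_derivative (\<lambda>d. 0)) (at x)"
    proof (rule has_derivative_transform_within_open[OF has_derivative_const assms(2,3)])
      show "0 = v \<bullet> H z" if "z \<in> N" for z
        using that assms(4) v by (auto simp: orthogonal_comp_def orthogonal_def inner_commute[of v])
    qed
    ultimately have "(\<lambda>d. v \<bullet> L d) = (\<lambda>d. 0)"
      by (rule has_derivative_unique)
    then show ?thesis by meson
  qed
  then have "range L \<subseteq> (V\<^sup>\<bottom>)\<^sup>\<bottom>"
    by (auto simp: orthogonal_comp_def orthogonal_def)
  then show ?thesis
    using assms(1) by (simp add: orthogonal_comp_self)
qed

text \<open>
  With \<open>L\<close> the derivative of the local defining function \<open>H\<close> at \<open>x\<close>, the chart is
  \<open>G z = L\<^sup>* (H z) + P z\<close>, where \<open>P\<close> maps into the kernel \<open>K\<close> of \<open>L\<close> and is injective there: the two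
  summands are orthogonal, so \<open>D G x\<close> is injective, and \<open>G z \<in> K\<close> holds exactly when \<open>H z = 0\<close>.
\<close>
lemma embedded_submanifold_chart:
  fixes C :: "'a::euclidean_space set"
  assumes "embedded_submanifold d C" "x \<in> C"
  obtains U and K :: "'a set" and G' :: "'a \<Rightarrow> 'a \<Rightarrow>\<^sub>L 'a" and G and N :: "'a \<Rightarrow>\<^sub>L 'a"
  where "open U" "x \<in> U" "subspace K" "continuous_on U G'"
    "\<And>z. z \<in> U \<Longrightarrow> (G has_derivative blinfun_apply (G' z)) (at z)"
    "\<And>v. N (G' x v) = v" "\<And>v. G' x (N v) = v"
    "\<And>z. z \<in> U \<Longrightarrow> z \<in> C \<longleftrightarrow> G z \<in> K"
    "\<And>z w. z \<in> U \<Longrightarrow> z \<in> C \<Longrightarrow> w \<in> K \<Longrightarrow> \<exists>t c. G' z t = w \<and>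
       (c has_derivative (\<lambda>s::real. s *\<^sub>R t)) (at 0) \<and> c 0 = z \<and> (\<forall>\<^sub>F s in at 0. c s \<in> C)"
proof -
  obtain N0 and V :: "'a set" and H :: "'a \<Rightarrow> 'a" where N0: "open N0" "x \<in> N0"
    and V: "subspace V" "dim V = DIM('a) - d" "H ` N0 \<subseteq> V" "H continuously_differentiable_on N0"
    and CN: "C \<inter> N0 = {z \<in> N0. H z = 0}"
    and rank: "dim (range (frechet_derivative H (at x))) = DIM('a) - d"
    using assms unfolding embedded_submanifold_def by blast
  obtain H' :: "'a \<Rightarrow> 'a \<Rightarrow>\<^sub>L 'a" where H': "continuous_on N0 H'"
    "\<And>z. z \<in> N0 \<Longrightarrow> (H has_derivative blinfun_apply (H' z)) (at z)"
    using V(4) unfolding continuously_differentiable_on_def by blast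
  define L where "L = blinfun_apply (H' x)"
  have linL: "linear L"
    unfolding L_def by (simp add: blinfun.bounded_linear_right bounded_linear.linear)
  have "frechet_derivative H (at x) = L"
    using frechet_derivative_at[OF H'(2)[OF N0(2)]] by (simp add: L_def)
  moreover have "range L \<subseteq> V"
    using derivative_in_subspace[OF V(1) N0 V(3) H'(2)[OF N0(2)]] by (simp add: L_def)
  ultimately have rangeL: "range L = V"
    using rank V linL by (intro subspace_dim_equal) (auto intro: linear_subspace_image)
  define K where "K = {z. L z = 0}"
  have K: "subspace K"
    unfolding K_def using linL by (rule linear_subspace_kernel)
  obtain B where B: "B \<subseteq> K" "independent B" "K \<subseteq> span B"
    using basis_exists[of K] by metis
  have finB: "finite B"
    using B(2) by (rule independent_imp_finite)
  define P where "P z = (\<Sum>b\<in>B. (b \<bullet> z) *\<^sub>R b)" for z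
  have PK: "P z \<in> K" for z
    unfolding P_def using B(1) by (intro subspace_sum[OF K] subspace_scale[OF K]) auto
  have linP: "linear P"
    unfolding P_def by (intro linearI) (simp_all add: inner_add_right scaleR_add_left sum.distrib
        scaleR_sum_right)
  define A where "A = adjoint L"
  have linA: "linear A"
    unfolding A_def using linL by (rule adjoint_linear)
  have A: "A u \<bullet> v = u \<bullet> L v" for u v
    unfolding A_def using adjoint_works[OF linL, of v u] by (simp add: inner_commute)
  have AK: "A u \<bullet> k = 0" if "k \<in> K" for u k
    using that by (simp add: A K_def)
  have A0: "u = 0" if u: "A u = 0" "u \<in> V" for u
  proof -
    obtain e where e: "u = L e"
      using u(2) rangeL by auto
    have "u \<bullet> u = A u \<bullet> e"
      unfolding A using e by simp
    then show ?thesis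
      using u(1) by simp
  qed
  define G where "G z = A (H z) + P z" for z
  define G' where "G' z = (Blinfun A o\<^sub>L H' z) + Blinfun P" for z
  have blA: "blinfun_apply (Blinfun A) = A" and blP: "blinfun_apply (Blinfun P) = P"
    using linA linP by (simp_all add: bounded_linear_Blinfun_apply linear_conv_bounded_linear)
  have G'_apply: "blinfun_apply (G' z) v = A (H' z v) + P v" for z v
    by (simp add: G'_def blinfun.add_left blA blP)
  have derG: "(G has_derivative blinfun_apply (G' z)) (at z)" if "z \<in> N0" for z
  proof -
    have "((\<lambda>z. A (H z) + P z) has_derivative (\<lambda>v. A (H' z v) + P v)) (at z)"
      by (rule has_derivative_add[OF bounded_linear.has_derivative[OF _ H'(2)[OF that]]
            bounded_linear_imp_has_derivative])
        (use linA linP in \<open>auto simp: linear_conv_bounded_linear\<close>)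
    then show ?thesis
      unfolding G_def G'_apply[abs_def] by (simp add: G'_apply[abs_def])
  qed
  have contG: "continuous_on N0 G'"
    unfolding G'_def by (intro continuous_intros H')
  have CG: "z \<in> C \<longleftrightarrow> G z \<in> K" if z: "z \<in> N0" for z
  proof
    assume "z \<in> C"
    then have "H z = 0" using z CN by blast
    then show "G z \<in> K"
      using PK linA by (simp add: G_def linear_0)
  next
    assume "G z \<in> K"
    then have "A (H z) \<in> K"
      using subspace_diff[OF K _ PK[of z], of "G z"] by (simp add: G_def)
    then have "A (H z) = 0"
      using AK[of "A (H z)" "H z"] by simp
    then have "H z = 0"
      using A0 V(3) z by blast
    then show "z \<in> C"
      using CN z by blast
  qed
  have inj: "v = 0" if v: "G' x v = 0" for v
  proof -
    have eq: "A (L v) + P v = 0"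
      using v by (simp add: G'_apply L_def)
    have "P v \<bullet> P v = (A (L v) + P v) \<bullet> P v - A (L v) \<bullet> P v"
      by (simp add: inner_add_left)
    also have "\<dots> = 0"
      using eq AK[OF PK] by simp
    finally have Pv: "P v = 0" by simp
    then have "A (L v) = 0"
      using eq by simp
    then have "L v = 0"
      using A0 rangeL by blast
    then have "v \<in> span B"
      using B(3) by (auto simp: K_def)
    moreover have "(\<Sum>b\<in>B. (b \<bullet> v)\<^sup>2) = P v \<bullet> v"
      by (simp add: P_def inner_sum_left power2_eq_square)
    then have "\<forall>b\<in>B. b \<bullet> v = 0"
      using finB Pv by (simp add: sum_nonneg_eq_0_iff)
    then have "\<forall>b\<in>B. orthogonal v b"
      by (simp add: orthogonal_def inner_commute)
    ultimately have "orthogonal v v"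
      using orthogonal_to_span by blast
    then show ?thesis
      by (simp add: orthogonal_def)
  qed
  have linG: "linear (blinfun_apply (G' x))"
    by (simp add: blinfun.bounded_linear_right bounded_linear.linear)
  then have "inj (blinfun_apply (G' x))"
    using inj by (simp add: linear_injective_0)
  then obtain Ni where Ni: "linear Ni" "Ni \<circ> blinfun_apply (G' x) = id"
    using linear_injective_left_inverse[OF linG] by blast
  define N where "N = Blinfun Ni"
  have N_apply: "blinfun_apply N = Ni"
    using Ni(1) by (simp add: N_def bounded_linear_Blinfun_apply linear_conv_bounded_linear)
  have N1: "N (G' x v) = v" for v
    using Ni(2) by (simp add: N_apply fun_eq_iff)
  have "blinfun_apply (G' x) \<circ> Ni = id"
    using linear_inverse_left[OF linG Ni(1)] Ni(2) by simp
  then have N2: "G' x (N v) = v" for v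
    by (simp add: N_apply fun_eq_iff)
  have "N o\<^sub>L G' x = id_blinfun"
    by (intro blinfun_eqI) (simp add: N1)
  note ift = inverse_function_theorem[OF N0(1) derG contG N0(2) this]
  obtain U W \<Gamma> \<Gamma>' where U: "open U" "U \<subseteq> N0" "x \<in> U" "open W" and "G x \<in> W"
    and hom: "homeomorphism U W G \<Gamma>"
    and \<Gamma>: "\<And>y. y \<in> W \<Longrightarrow> (\<Gamma> has_derivative (\<Gamma>' y)) (at y)"
    "\<And>y. y \<in> W \<Longrightarrow> \<Gamma>' y = inv (blinfun_apply (G' (\<Gamma> y)))"
    "\<And>y. y \<in> W \<Longrightarrow> bij (blinfun_apply (G' (\<Gamma> y)))"
    by (rule ift) (assumption, rule that)
  have curve: "\<exists>t c. G' z t = w \<and> (c has_derivative (\<lambda>s::real. s *\<^sub>R t)) (at 0) \<and> c 0 = z \<and>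
      (\<forall>\<^sub>F s in at 0. c s \<in> C)" if z: "z \<in> U" "z \<in> C" and w: "w \<in> K" for z w
  proof -
    have Gz: "G z \<in> W" "\<Gamma> (G z) = z"
      using hom z by (auto simp: homeomorphism_def)
    define t where "t = inv (blinfun_apply (G' z)) w"
    define c where "c s = \<Gamma> (G z + s *\<^sub>R w)" for s :: real
    have "G' z t = w"
      using \<Gamma>(3)[OF Gz(1)] Gz(2) by (simp add: t_def bij_is_surj surj_f_inv_f)
    moreover have "(c has_derivative (\<lambda>s. s *\<^sub>R t)) (at 0)"
    proof -
      have "(\<Gamma> has_derivative \<Gamma>' (G z)) (at (G z + 0 *\<^sub>R w))"
        using \<Gamma>(1)[OF Gz(1)] by simp
      moreover have "((\<lambda>s::real. G z + s *\<^sub>R w) has_derivative (\<lambda>s. s *\<^sub>R w)) (at 0)"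
        by (auto intro!: derivative_eq_intros)
      ultimately have "(c has_derivative (\<lambda>s. \<Gamma>' (G z) (s *\<^sub>R w))) (at 0)"
        unfolding c_def by (rule has_derivative_compose[rotated])
      moreover have "\<Gamma>' (G z) (s *\<^sub>R w) = s *\<^sub>R t" for s
        using \<Gamma>(2)[OF Gz(1)] Gz(2) linear_scale[OF has_derivative_linear[OF \<Gamma>(1)[OF Gz(1)]]]
        by (simp add: t_def)
      ultimately show ?thesis by simp
    qed
    moreover have "c 0 = z"
      by (simp add: c_def Gz)
    moreover have "\<forall>\<^sub>F s in at 0. c s \<in> C"
    proof -
      have "((\<lambda>s::real. G z + s *\<^sub>R w) \<longlongrightarrow> G z + 0 *\<^sub>R w) (at 0)"
        by (intro tendsto_intros)
      then have "\<forall>\<^sub>F s :: real in at 0. G z + s *\<^sub>R w \<in> W"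
        using U(4) Gz(1) by (intro topological_tendstoD) auto
      then show ?thesis
      proof eventually_elim
        case (elim s)
        then have "c s \<in> U" "G (c s) = G z + s *\<^sub>R w"
          using hom by (auto simp: homeomorphism_def c_def)
        moreover have "G z + s *\<^sub>R w \<in> K"
          using K CG z w U(2) by (auto intro: subspace_add subspace_scale)
        ultimately show ?case
          using CG U(2) by auto
      qed
    qed
    ultimately show ?thesis by blast
  qed
  show thesis
    by (rule that[of U K G' G N])
      (use U K contG derG N1 N2 CG curve in \<open>auto intro: continuous_on_subset\<close>)
qed

text \<open>
  Every tangent vector of \<open>C\<close> at \<open>x\<close> is a limit of tangent vectors at the points \<open>X n\<close>, so that
  orthogonality of the \<open>V n\<close> to the tangent spaces passes to the limit.
\<close>
lemma normal_cone_embedded_submanifold: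
  fixes C :: "'a::euclidean_space set"
  assumes "embedded_submanifold d C" "v \<in> normal_cone C x"
  shows "v \<in> frechet_subdiff (indicator_fun C) x"
proof -
  obtain X V where X: "X \<longlonglongrightarrow> x" and V: "V \<longlonglongrightarrow> v"
    and XV: "\<And>n. V n \<in> frechet_subdiff (indicator_fun C) (X n)" and "indicator_fun C x < \<infinity>"
    using assms(2) unfolding normal_cone_def limiting_subdiff_def by blast
  have XC: "X n \<in> C" for n
    using XV[of n] by (simp add: frechet_subdiff_indicator_iff)
  have xC: "x \<in> C"
    using \<open>indicator_fun C x < \<infinity>\<close> by (auto simp: indicator_fun_def split: if_splits)
  obtain U and K :: "'a set" and G' :: "'a \<Rightarrow> 'a \<Rightarrow>\<^sub>L 'a" and G and N :: "'a \<Rightarrow>\<^sub>L 'a"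
    where U: "open U" "x \<in> U" and K: "subspace K" and contG: "continuous_on U G'"
    and derG: "\<And>z. z \<in> U \<Longrightarrow> (G has_derivative blinfun_apply (G' z)) (at z)"
    and N: "\<And>v. N (G' x v) = v" "\<And>v. G' x (N v) = v"
    and CG: "\<And>z. z \<in> U \<Longrightarrow> z \<in> C \<longleftrightarrow> G z \<in> K"
    and curve: "\<And>z w. z \<in> U \<Longrightarrow> z \<in> C \<Longrightarrow> w \<in> K \<Longrightarrow> \<exists>t c. G' z t = w \<and>
       (c has_derivative (\<lambda>s::real. s *\<^sub>R t)) (at 0) \<and> c 0 = z \<and> (\<forall>\<^sub>F s in at 0. c s \<in> C)"
    by (rule embedded_submanifold_chart[OF assms(1) xC]) (rule that)
  have tangent: "\<exists>t. G' z t = w \<and> a \<bullet> t = 0"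
    if z: "z \<in> U" "z \<in> C" and w: "w \<in> K" and a: "a \<in> frechet_subdiff (indicator_fun C) z"
    for z w a
  proof -
    obtain t c where t: "G' z t = w" and c: "(c has_derivative (\<lambda>s::real. s *\<^sub>R t)) (at 0)"
      "c 0 = z" "\<forall>\<^sub>F s in at 0. c s \<in> C"
      using curve[OF z w] by blast
    have "a \<bullet> t \<le> 0"
      by (rule frechet_normal_curve[OF a c])
    have "((\<lambda>s. c (- s)) has_derivative (\<lambda>s. s *\<^sub>R (- t))) (at 0)"
    proof -
      have "(c has_derivative (\<lambda>s. s *\<^sub>R t)) (at (- 0))"
        using c(1) by simp
      moreover have "((\<lambda>s::real. - s) has_derivative (\<lambda>s. - s)) (at 0)"
        by (auto intro!: derivative_eq_intros)
      ultimately have "((\<lambda>s. c (- s)) has_derivative (\<lambda>s. (- s) *\<^sub>R t)) (at 0)"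
        by (rule has_derivative_compose[rotated])
      then show ?thesis by simp
    qed
    moreover have "\<forall>\<^sub>F s in at 0. c (- s) \<in> C"
    proof (rule eventually_compose_filterlim[OF c(3)])
      show "filterlim uminus (at 0) (at (0::real))"
        by (rule filterlim_atI) (auto intro!: tendsto_eq_intros simp: eventually_at_filter)
    qed
    ultimately have "a \<bullet> (- t) \<le> 0"
      by (intro frechet_normal_curve[OF a, of "\<lambda>s. c (- s)"]) (auto simp: c(2))
    then show ?thesis
      using t \<open>a \<bullet> t \<le> 0\<close> by auto
  qed
  have orth: "v \<bullet> t = 0" if t: "G' x t \<in> K" for t
  proof -
    have evU: "\<forall>\<^sub>F n in sequentially. X n \<in> U"
      using X U by (rule topological_tendstoD)
    have "\<forall>n. \<exists>s. X n \<in> U \<longrightarrow> G' (X n) s = G' x t \<and> V n \<bullet> s = 0"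
      using tangent[OF _ XC t XV] by blast
    then obtain T where T: "\<And>n. X n \<in> U \<Longrightarrow> G' (X n) (T n) = G' x t \<and> V n \<bullet> T n = 0"
      by metis
    define \<delta> where "\<delta> n = norm N * norm (G' x - G' (X n))" for n
    have "((\<lambda>n. G' (X n)) \<longlongrightarrow> G' x) sequentially"
      using continuous_on_tendsto_compose[OF contG X U(2) evU] .
    then have "(\<lambda>n. norm N * norm (G' x - G' (X n))) \<longlonglongrightarrow> norm N * norm (G' x - G' x)"
      by (intro tendsto_intros)
    then have \<delta>: "\<delta> \<longlonglongrightarrow> 0"
      by (simp add: \<delta>_def[abs_def])
    then have "\<forall>\<^sub>F n in sequentially. \<delta> n < 1 / 2"
      by (rule order_tendstoD) simp
    with evU have "\<forall>\<^sub>F n in sequentially. norm (T n - t) \<le> 2 * \<delta> n * norm t"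
    proof eventually_elim
      case (elim n)
      have "T n - t = N ((G' x - G' (X n)) (T n))"
        using T[OF elim(1)] by (simp add: blinfun.diff_left blinfun.diff_right N)
      then have "norm (T n - t) \<le> norm N * norm ((G' x - G' (X n)) (T n))"
        by (simp only: norm_blinfun)
      also have "\<dots> \<le> norm N * (norm (G' x - G' (X n)) * norm (T n))"
        by (intro mult_left_mono norm_blinfun) simp
      finally have 1: "norm (T n - t) \<le> \<delta> n * norm (T n)"
        by (simp add: \<delta>_def mult.assoc)
      have "norm (T n) \<le> norm t + norm (T n - t)"
        using norm_triangle_ineq[of t "T n - t"] by simp
      also have "\<dots> \<le> norm t + 1 / 2 * norm (T n)"
        using 1 mult_right_mono[of "\<delta> n" "1 / 2" "norm (T n)"] elim(2) by simp
      finally have "norm (T n) \<le> 2 * norm t"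
        by simp
      then have "\<delta> n * norm (T n) \<le> \<delta> n * (2 * norm t)"
        by (intro mult_left_mono) (auto simp: \<delta>_def)
      with 1 show ?case
        by simp
    qed
    moreover have "(\<lambda>n. 2 * \<delta> n * norm t) \<longlonglongrightarrow> 0"
      using \<delta> by (auto intro!: tendsto_eq_intros)
    ultimately have "(\<lambda>n. T n - t) \<longlonglongrightarrow> 0"
      by (rule Lim_null_comparison)
    then have "T \<longlonglongrightarrow> t"
      by (rule LIM_zero_cancel)
    then have "(\<lambda>n. V n \<bullet> T n) \<longlonglongrightarrow> v \<bullet> t"
      by (intro tendsto_intros V)
    moreover have "\<forall>\<^sub>F n in sequentially. V n \<bullet> T n = 0"
      using evU by eventually_elim (simp add: T)
    then have "(\<lambda>n. V n \<bullet> T n) \<longlonglongrightarrow> 0"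
      by (rule tendsto_eventually)
    ultimately show ?thesis
      by (rule LIMSEQ_unique)
  qed
  have "\<forall>\<^sub>F z in at x. z \<in> C \<longrightarrow> v \<bullet> (z - x) \<le> e * norm (z - x)" if "e > 0" for e
  proof -
    define e' where "e' = e / (norm v * norm N + 1)"
    have "0 \<le> norm v * norm N"
      by simp
    then have e': "0 < e'" "norm v * norm N * e' \<le> e"
      using that by (simp_all add: e'_def field_simps add_pos_nonneg add_nonneg_pos)
    have "\<forall>\<^sub>F z in at x. norm (G z - G x - G' x (z - x)) \<le> e' * norm (z - x)"
      using derG[OF U(2)] e'(1) by (simp add: has_derivative_within_alt2)
    moreover have "\<forall>\<^sub>F z in at x. z \<in> U"
      using U by (auto intro: eventually_at_in_open')
    ultimately show ?thesis
    proof eventually_elim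
      case (elim z)
      show ?case
      proof
        assume "z \<in> C"
        define r where "r = G z - G x - G' x (z - x)"
        have "G z - G x \<in> K"
          using CG U xC elim(2) \<open>z \<in> C\<close> by (auto intro: subspace_diff[OF K])
        then have "v \<bullet> N (G z - G x) = 0"
          by (intro orth) (simp add: N)
        moreover have "N (G z - G x) = (z - x) + N r"
          by (simp add: r_def blinfun.diff_right N)
        ultimately have "v \<bullet> (z - x) = - (v \<bullet> N r)"
          by (simp add: inner_add_right)
        also have "\<dots> \<le> norm v * norm (N r)"
          using Cauchy_Schwarz_ineq2[of v "N r"] by linarith
        also have "\<dots> \<le> norm v * (norm N * (e' * norm (z - x)))"
          using elim(1) unfolding r_def[symmetric]
          by (intro mult_left_mono order_trans[OF norm_blinfun[of N r]]) auto
        also have "\<dots> = (norm v * norm N * e') * norm (z - x)"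
          by simp
        also have "\<dots> \<le> e * norm (z - x)"
          using e'(2) by (intro mult_right_mono) auto
        finally show "v \<bullet> (z - x) \<le> e * norm (z - x)" .
      qed
    qed
  qed
  then show ?thesis
    using xC by (simp add: frechet_subdiff_indicator_iff)
qed

subsection \<open>Stationarity of cluster points\<close>

lemma has_derivative_lower_bound:
  fixes q :: "'a::real_normed_vector \<Rightarrow> real"
  assumes "(q has_derivative D) (at x)" "e > 0"
  shows "\<forall>\<^sub>F z in at x. q x + D (z - x) - e * norm (z - x) \<le> q z"
proof -
  have "\<forall>\<^sub>F z in at x. norm (q z - q x - D (z - x)) \<le> e * norm (z - x)"
    using assms by (simp add: has_derivative_within_alt2)
  then show ?thesis
    by eventually_elim (simp add: abs_le_iff)
qed

lemma composite_subgradient_lower_bound: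
  fixes h :: "'a::real_normed_vector \<Rightarrow> real" and S :: "'a \<Rightarrow> 'z::real_inner"
  assumes h: "(h has_derivative h') (at x)" and S: "(S has_derivative S') (at x)"
    and sub: "\<And>z. g (S x) + v \<bullet> (z - S x) - \<kappa> * (norm (z - S x))\<^sup>2 \<le> g z" and e: "e > 0"
  shows "\<forall>\<^sub>F z in at x. h x + g (S x) + (h' (z - x) + v \<bullet> S' (z - x)) - e * norm (z - x)
    \<le> h z + g (S z)"
proof -
  define q where "q z = h z + (g (S x) + v \<bullet> (S z - S x) - \<kappa> * ((S z - S x) \<bullet> (S z - S x)))" for z
  have "(q has_derivative (\<lambda>d. h' d + v \<bullet> S' d)) (at x)"
    unfolding q_def by (auto intro!: derivative_eq_intros h S)
  from has_derivative_lower_bound[OF this e]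
  have "\<forall>\<^sub>F z in at x. q x + (h' (z - x) + v \<bullet> S' (z - x)) - e * norm (z - x) \<le> q z" .
  then show ?thesis
  proof eventually_elim
    case (elim z)
    have "q z \<le> h z + g (S z)"
      using sub[of "S z"] by (simp add: q_def power2_norm_eq_inner)
    then show ?case
      using elim by (simp add: q_def)
  qed
qed

lemma gradient_inner:
  fixes f :: "'a::euclidean_space \<Rightarrow> real"
  assumes f: "(f has_derivative D) (at x)"
  shows "gradient f x \<bullet> d = D d"
proof -
  have D: "D d = d \<bullet> adjoint D 1" for d
    using adjoint_works[OF has_derivative_linear[OF f], of d 1] by simp
  have "gradient f x = adjoint D 1"
    unfolding gradient_def
  proof (rule the_equality)
    have "(\<lambda>d. d \<bullet> adjoint D 1) = D"
      using D by auto
    then show "GDERIV f x :> adjoint D 1"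
      using f by (simp add: gderiv_def)
    show "w = adjoint D 1" if "GDERIV f x :> w" for w
    proof -
      have "(\<lambda>d. d \<bullet> w) = D"
        using that f unfolding gderiv_def by (rule has_derivative_unique)
      then show ?thesis
        using D by (metis vector_eq_ldot)
    qed
  qed
  then show ?thesis
    by (simp add: D[of d] inner_commute)
qed

lemma continuously_differentiable_onE:
  assumes "f continuously_differentiable_on UNIV"
  obtains f' where "\<And>x. isCont f' x" "\<And>x. (f has_derivative blinfun_apply (f' x)) (at x)"
  using assms unfolding continuously_differentiable_on_def
  by (auto simp: continuous_on_eq_continuous_at)

lemma smoothed_gradient_limit:
  fixes h :: "'x::euclidean_space \<Rightarrow> real" and S :: "'x \<Rightarrow> 'z::euclidean_space"
    and \<phi> :: "'y::euclidean_space \<Rightarrow> 'x"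
  assumes g: "L-lipschitz_on UNIV g" "weakly_convex \<eta> g" "0 < \<eta>"
    and h: "\<And>x. isCont h' x" "\<And>x. (h has_derivative blinfun_apply (h' x)) (at x)"
    and S: "\<And>x. isCont S' x" "\<And>x. (S has_derivative blinfun_apply (S' x)) (at x)"
    and \<phi>: "\<And>x. isCont \<phi>' x" "\<And>x. (\<phi> has_derivative blinfun_apply (\<phi>' x)) (at x)"
    and \<nu>: "\<And>k. 0 < \<nu> k" "\<And>k. \<nu> k \<le> 1 / (2 * \<eta>)" "\<nu> \<longlonglongrightarrow> 0"
    and Y: "Y \<longlonglongrightarrow> u"
    and grad: "(\<lambda>k. gradient (smoothed h S g (\<nu> k) \<circ> \<phi>) (Y k)) \<longlonglongrightarrow> 0"
  shows "\<exists>v. (\<forall>z. g (S (\<phi> u)) + v \<bullet> (z - S (\<phi> u)) - \<eta> / 2 * (norm (z - S (\<phi> u)))\<^sup>2 \<le> g z) \<and>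
    (\<forall>d. h' (\<phi> u) (\<phi>' u d) + v \<bullet> S' (\<phi> u) (\<phi>' u d) = 0)"
proof -
  have "\<exists>p w. S (\<phi> (Y k)) - p = \<nu> k *\<^sub>R w \<and> norm w \<le> L \<and>
      (\<forall>z. g p + w \<bullet> (z - p) - \<eta> / 2 * (norm (z - p))\<^sup>2 \<le> g z) \<and>
      (moreau_envelope (\<nu> k) g has_derivative (\<lambda>d. w \<bullet> d)) (at (S (\<phi> (Y k))))" for k
    using moreau_envelope_prox[OF g \<nu>(1,2), of "S (\<phi> (Y k))" k] by metis
  then obtain p w where pw: "\<And>k. S (\<phi> (Y k)) - p k = \<nu> k *\<^sub>R w k" and w: "\<And>k. norm (w k) \<le> L"
    and sub: "\<And>k z. g (p k) + w k \<bullet> (z - p k) - \<eta> / 2 * (norm (z - p k))\<^sup>2 \<le> g z"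
    and env: "\<And>k. (moreau_envelope (\<nu> k) g has_derivative (\<lambda>d. w k \<bullet> d)) (at (S (\<phi> (Y k))))"
    by metis
  have grad_eq: "gradient (smoothed h S g (\<nu> k) \<circ> \<phi>) (Y k) \<bullet> d
      = h' (\<phi> (Y k)) (\<phi>' (Y k) d) + w k \<bullet> S' (\<phi> (Y k)) (\<phi>' (Y k) d)" for k d
  proof (rule gradient_inner)
    have "((\<lambda>x. h (\<phi> x)) has_derivative (\<lambda>d. h' (\<phi> (Y k)) (\<phi>' (Y k) d))) (at (Y k))"
      by (rule has_derivative_compose[OF \<phi>(2) h(2)])
    moreover have "((\<lambda>x. moreau_envelope (\<nu> k) g (S (\<phi> x))) has_derivative
        (\<lambda>d. w k \<bullet> S' (\<phi> (Y k)) (\<phi>' (Y k) d))) (at (Y k))"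
      by (rule has_derivative_compose[OF has_derivative_compose[OF \<phi>(2) S(2)] env])
    ultimately show "(smoothed h S g (\<nu> k) \<circ> \<phi> has_derivative
        (\<lambda>d. h' (\<phi> (Y k)) (\<phi>' (Y k) d) + w k \<bullet> S' (\<phi> (Y k)) (\<phi>' (Y k) d))) (at (Y k))"
      unfolding smoothed_def comp_def by (rule has_derivative_add)
  qed
  have "\<forall>k. w k \<in> cball 0 L"
    using w by simp
  then obtain v r where r: "strict_mono r" and v: "(w \<circ> r) \<longlonglongrightarrow> v"
    using compact_cball[of "0::'z" L] unfolding compact_def by metis
  have Yr: "(\<lambda>k. Y (r k)) \<longlonglongrightarrow> u" and \<nu>r: "(\<lambda>k. \<nu> (r k)) \<longlonglongrightarrow> 0"
    using LIMSEQ_subseq_LIMSEQ[OF Y r] LIMSEQ_subseq_LIMSEQ[OF \<nu>(3) r] by (simp_all add: comp_def)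
  have wr: "(\<lambda>k. w (r k)) \<longlonglongrightarrow> v"
    using v by (simp add: comp_def)
  have \<phi>r: "(\<lambda>k. \<phi> (Y (r k))) \<longlonglongrightarrow> \<phi> u"
    by (rule isCont_tendsto_compose[OF has_derivative_continuous[OF \<phi>(2)] Yr])
  have Sr: "(\<lambda>k. S (\<phi> (Y (r k)))) \<longlonglongrightarrow> S (\<phi> u)"
    by (rule isCont_tendsto_compose[OF has_derivative_continuous[OF S(2)] \<phi>r])
  have "(\<lambda>k. S (\<phi> (Y (r k))) - \<nu> (r k) *\<^sub>R w (r k)) \<longlonglongrightarrow> S (\<phi> u) - 0 *\<^sub>R v"
    by (intro tendsto_intros Sr \<nu>r wr)
  moreover have "S (\<phi> (Y (r k))) - \<nu> (r k) *\<^sub>R w (r k) = p (r k)" for k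
    using pw[of "r k"] by (simp add: algebra_simps)
  ultimately have pr: "(\<lambda>k. p (r k)) \<longlonglongrightarrow> S (\<phi> u)"
    by simp
  have "isCont g z" for z
    using lipschitz_on_continuous_on[OF g(1)] by (simp add: continuous_on_eq_continuous_at)
  then have gr: "(\<lambda>k. g (p (r k))) \<longlonglongrightarrow> g (S (\<phi> u))"
    using pr by (rule isCont_tendsto_compose)
  show ?thesis
  proof (intro exI[of _ v] conjI allI)
    fix z
    have "(\<lambda>k. g (p (r k)) + w (r k) \<bullet> (z - p (r k)) - \<eta> / 2 * (norm (z - p (r k)))\<^sup>2)
        \<longlonglongrightarrow> g (S (\<phi> u)) + v \<bullet> (z - S (\<phi> u)) - \<eta> / 2 * (norm (z - S (\<phi> u)))\<^sup>2"
      by (intro tendsto_intros gr wr pr)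
    then show "g (S (\<phi> u)) + v \<bullet> (z - S (\<phi> u)) - \<eta> / 2 * (norm (z - S (\<phi> u)))\<^sup>2 \<le> g z"
      by (rule LIMSEQ_le_const2) (use sub in blast)
  next
    fix d
    have \<phi>d: "(\<lambda>k. \<phi>' (Y (r k)) d) \<longlonglongrightarrow> \<phi>' u d"
      by (intro tendsto_intros isCont_tendsto_compose[OF \<phi>(1) Yr])
    have "(\<lambda>k. h' (\<phi> (Y (r k))) (\<phi>' (Y (r k)) d) + w (r k) \<bullet> S' (\<phi> (Y (r k))) (\<phi>' (Y (r k)) d))
        \<longlonglongrightarrow> h' (\<phi> u) (\<phi>' u d) + v \<bullet> S' (\<phi> u) (\<phi>' u d)"
      by (intro tendsto_intros \<phi>d wr isCont_tendsto_compose[OF h(1) \<phi>r]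
          isCont_tendsto_compose[OF S(1) \<phi>r])
    moreover have "(\<lambda>k. gradient (smoothed h S g (\<nu> (r k)) \<circ> \<phi>) (Y (r k)) \<bullet> d) \<longlonglongrightarrow> 0 \<bullet> d"
      using LIMSEQ_subseq_LIMSEQ[OF grad r] by (intro tendsto_intros) (simp add: comp_def)
    ultimately show "h' (\<phi> u) (\<phi>' u d) + v \<bullet> S' (\<phi> u) (\<phi>' u d) = 0"
      unfolding grad_eq using LIMSEQ_unique by force
  qed
qed

lemma smoothed_limit_stationary:
  fixes h :: "'x::euclidean_space \<Rightarrow> real" and S :: "'x \<Rightarrow> 'z::euclidean_space"
    and \<phi> :: "'y::euclidean_space \<Rightarrow> 'x"
  assumes C: "embedded_submanifold d C" "\<phi> u \<in> C"
    and g: "L-lipschitz_on UNIV g" "weakly_convex \<eta> g" "0 < \<eta>"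
    and h: "h continuously_differentiable_on UNIV" and S: "S continuously_differentiable_on UNIV"
    and \<phi>: "\<phi> continuously_differentiable_on UNIV"
    and \<nu>: "\<And>k. 0 < \<nu> k" "\<And>k. \<nu> k \<le> 1 / (2 * \<eta>)" "\<nu> \<longlonglongrightarrow> 0"
    and Y: "Y \<longlonglongrightarrow> u"
    and grad: "(\<lambda>k. gradient (smoothed h S g (\<nu> k) \<circ> \<phi>) (Y k)) \<longlonglongrightarrow> 0"
  shows "0 \<in> limiting_subdiff (\<lambda>y. ereal (h (\<phi> y) + g (S (\<phi> y)))) u"
    and "{v. adjoint (frechet_derivative \<phi> (at u)) v = 0} \<subseteq> normal_cone C (\<phi> u) \<Longrightarrow>
      0 \<in> limiting_subdiff (\<lambda>x. ereal (h x + g (S x)) + indicator_fun C x) (\<phi> u)"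
proof -
  obtain h' where h': "\<And>x. isCont h' x" "\<And>x. (h has_derivative blinfun_apply (h' x)) (at x)"
    by (rule continuously_differentiable_onE[OF h]) (rule that)
  obtain S' where S': "\<And>x. isCont S' x" "\<And>x. (S has_derivative blinfun_apply (S' x)) (at x)"
    by (rule continuously_differentiable_onE[OF S]) (rule that)
  obtain \<phi>' where \<phi>': "\<And>x. isCont \<phi>' x" "\<And>x. (\<phi> has_derivative blinfun_apply (\<phi>' x)) (at x)"
    by (rule continuously_differentiable_onE[OF \<phi>]) (rule that)
  have "\<exists>v. (\<forall>z. g (S (\<phi> u)) + v \<bullet> (z - S (\<phi> u)) - \<eta> / 2 * (norm (z - S (\<phi> u)))\<^sup>2 \<le> g z) \<and>
      (\<forall>d. h' (\<phi> u) (\<phi>' u d) + v \<bullet> S' (\<phi> u) (\<phi>' u d) = 0)"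
    by (rule smoothed_gradient_limit[where L = L and h = h and \<nu> = \<nu> and Y = Y])
      (fact g h' S' \<phi>' \<nu> Y grad)+
  then obtain v where v: "\<And>z. g (S (\<phi> u)) + v \<bullet> (z - S (\<phi> u)) - \<eta> / 2 * (norm (z - S (\<phi> u)))\<^sup>2 \<le> g z"
    and zero: "\<And>d. h' (\<phi> u) (\<phi>' u d) + v \<bullet> S' (\<phi> u) (\<phi>' u d) = 0"
    by blast
  have "0 \<in> frechet_subdiff (\<lambda>y. ereal (h (\<phi> y) + g (S (\<phi> y)))) u"
    unfolding frechet_subdiff_real_iff
  proof (intro allI impI)
    fix e :: real assume e: "e > 0"
    have h\<phi>: "((\<lambda>y. h (\<phi> y)) has_derivative (\<lambda>d. h' (\<phi> u) (\<phi>' u d))) (at u)"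
      by (rule has_derivative_compose[OF \<phi>'(2) h'(2)])
    have S\<phi>: "((\<lambda>y. S (\<phi> y)) has_derivative (\<lambda>d. S' (\<phi> u) (\<phi>' u d))) (at u)"
      by (rule has_derivative_compose[OF \<phi>'(2) S'(2)])
    show "\<forall>\<^sub>F y in at u.
        h (\<phi> u) + g (S (\<phi> u)) + 0 \<bullet> (y - u) - e * norm (y - u) \<le> h (\<phi> y) + g (S (\<phi> y))"
      using composite_subgradient_lower_bound[OF h\<phi> S\<phi> v e] by (simp add: zero)
  qed
  then show "0 \<in> limiting_subdiff (\<lambda>y. ereal (h (\<phi> y) + g (S (\<phi> y)))) u"
    using frechet_subdiff_subset_limiting by blast
  define D where "D d = h' (\<phi> u) d + v \<bullet> S' (\<phi> u) d" for d
  define a where "a = adjoint D 1"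
  have "linear D"
    unfolding D_def by (intro linearI) (simp_all add: blinfun.add_right blinfun.scaleR_right
        inner_add_right algebra_simps)
  then have a: "D d = a \<bullet> d" for d
    using adjoint_works[of D d 1] by (simp add: a_def inner_commute)
  have lin: "linear (frechet_derivative \<phi> (at u))"
    by (intro linear_frechet_derivative) (use \<phi>'(2) differentiableI in blast)
  have "frechet_derivative \<phi> (at u) = blinfun_apply (\<phi>' u)"
    using frechet_derivative_at[OF \<phi>'(2)] by simp
  then have "frechet_derivative \<phi> (at u) d \<bullet> (- a) = 0" for d
    using zero[of d] a[of "\<phi>' u d"] by (simp add: D_def inner_commute)
  then have "d \<bullet> adjoint (frechet_derivative \<phi> (at u)) (- a) = 0" for d
    by (simp only: adjoint_works[OF lin])
  then have ker: "adjoint (frechet_derivative \<phi> (at u)) (- a) = 0"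
    by (metis inner_eq_zero_iff)
  assume "{v. adjoint (frechet_derivative \<phi> (at u)) v = 0} \<subseteq> normal_cone C (\<phi> u)"
  then have "- a \<in> frechet_subdiff (indicator_fun C) (\<phi> u)"
    using ker by (intro normal_cone_embedded_submanifold[OF C(1)]) auto
  then have normal: "\<forall>\<^sub>F x in at (\<phi> u). x \<in> C \<longrightarrow> (- a) \<bullet> (x - \<phi> u) \<le> e * norm (x - \<phi> u)"
    if "e > 0" for e
    using that by (simp add: frechet_subdiff_indicator_iff)
  have "0 \<in> frechet_subdiff (\<lambda>x. ereal (h x + g (S x)) + indicator_fun C x) (\<phi> u)"
    unfolding frechet_subdiff_add_indicator_iff
  proof (intro conjI allI impI C)
    fix e :: real assume "e > 0"
    then have e: "e / 2 > 0" by simp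
    from composite_subgradient_lower_bound[OF h'(2) S'(2) v e] normal[OF e]
    show "\<forall>\<^sub>F x in at (\<phi> u). x \<in> C \<longrightarrow>
        h (\<phi> u) + g (S (\<phi> u)) + 0 \<bullet> (x - \<phi> u) - e * norm (x - \<phi> u) \<le> h x + g (S x)"
    proof eventually_elim
      case (elim x)
      show ?case
      proof
        assume "x \<in> C"
        then have "- (a \<bullet> (x - \<phi> u)) \<le> e / 2 * norm (x - \<phi> u)"
          using elim(2) by simp
        with elim(1) show "h (\<phi> u) + g (S (\<phi> u)) + 0 \<bullet> (x - \<phi> u) - e * norm (x - \<phi> u)
            \<le> h x + g (S x)"
          unfolding D_def[symmetric] a inner_zero_left by argo
      qed
    qed
  qed
  then show "0 \<in> limiting_subdiff (\<lambda>x. ereal (h x + g (S x)) + indicator_fun C x) (\<phi> u)"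
    using frechet_subdiff_subset_limiting by blast
qed

subsection \<open>Descent and convergence rate\<close>

text \<open>\<open>f n (y n) + K * \<mu> n\<close> is a Lyapunov function.\<close>
lemma descent_weighted_sum:
  fixes f :: "nat \<Rightarrow> 'y \<Rightarrow> real" and s \<mu> \<gamma> :: "nat \<Rightarrow> real"
  assumes descent: "\<And>n. n \<ge> 1 \<Longrightarrow> f n (y (Suc n)) \<le> f n (y n) - c * \<gamma> n * s n"
    and incr: "\<And>n u. n \<ge> 1 \<Longrightarrow> f n u \<le> f (Suc n) u"
    and diff: "\<And>n u. n \<ge> 1 \<Longrightarrow> f (Suc n) u \<le> f n u + K * (\<mu> n - \<mu> (Suc n))"
    and \<mu>: "\<And>n. n \<ge> 1 \<Longrightarrow> 0 < \<mu> n" "\<And>n. n \<ge> 1 \<Longrightarrow> \<mu> n \<le> 1 / \<eta>"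
    and \<gamma>: "\<And>n. n \<ge> 1 \<Longrightarrow> \<beta> / (w1 + w2 / \<mu> n) \<le> \<gamma> n"
    and pos: "0 < c" "0 < \<beta>" "0 < \<eta>" "0 \<le> w1" "0 < w2" "0 \<le> K" "\<And>n. 0 \<le> s n"
    and b: "\<And>u. b \<le> f 1 u"
    and k: "1 \<le> k1" "k1 \<le> k2"
  shows "c * \<beta> * \<eta> / (w1 + \<eta> * w2) * (\<Sum>n=k1..k2. \<mu> n * s n) \<le> f 1 (y 1) - b + K * \<mu> 1"
proof -
  define E where "E n = f n (y n) + K * \<mu> n" for n
  define \<rho> where "\<rho> = c * \<beta> * \<eta> / (w1 + \<eta> * w2)"
  have "w1 + \<eta> * w2 > 0"
    using pos by (simp add: add_nonneg_pos)
  then have \<rho>: "0 < \<rho>"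
    using pos by (simp add: \<rho>_def)
  have decrease: "\<rho> * (\<mu> n * s n) \<le> E n - E (Suc n)" if n: "n \<ge> 1" for n
  proof -
    have \<mu>n: "0 < \<mu> n" "\<eta> * \<mu> n \<le> 1"
      using \<mu>[OF n] pos by (auto simp: field_simps)
    have "w1 * (\<eta> * \<mu> n) \<le> w1"
      using pos \<mu>n by (intro mult_left_le) auto
    moreover have eq: "(w1 + w2 / \<mu> n) * (\<eta> * \<mu> n) = w1 * (\<eta> * \<mu> n) + \<eta> * w2"
      using \<mu>n by (simp add: field_simps)
    moreover have "0 < w1 * (\<eta> * \<mu> n) + \<eta> * w2"
      using pos \<mu>n by (simp add: add_nonneg_pos)
    ultimately have "(\<eta> * \<mu> n) / (w1 + \<eta> * w2) \<le> (\<eta> * \<mu> n) / ((w1 + w2 / \<mu> n) * (\<eta> * \<mu> n))"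
      unfolding eq using pos \<mu>n \<open>w1 + \<eta> * w2 > 0\<close> by (intro divide_left_mono) auto
    also have "\<dots> = 1 / (w1 + w2 / \<mu> n)"
      using pos \<mu>n by simp
    finally have "\<beta> * ((\<eta> * \<mu> n) / (w1 + \<eta> * w2)) \<le> \<beta> * (1 / (w1 + w2 / \<mu> n))"
      using pos by (intro mult_left_mono) auto
    also have "\<dots> \<le> \<gamma> n"
      using \<gamma>[OF n] by simp
    finally have "(c * s n) * (\<beta> * ((\<eta> * \<mu> n) / (w1 + \<eta> * w2))) \<le> (c * s n) * \<gamma> n"
      using pos by (intro mult_left_mono) auto
    then have "\<rho> * (\<mu> n * s n) \<le> c * \<gamma> n * s n"
      by (simp add: \<rho>_def mult_ac)
    then show ?thesis
      using descent[OF n] diff[OF n, of "y (Suc n)"] by (simp add: E_def algebra_simps)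
  qed
  have E1: "E n \<le> E 1" if "1 \<le> n" for n
    using that
  proof (induction n rule: dec_induct)
    case (step n)
    have "0 \<le> \<rho> * (\<mu> n * s n)"
      using \<rho> pos(7) \<mu>(1)[OF step(1)] by simp
    then show ?case
      using decrease[OF step(1)] step by linarith
  qed simp
  have "b \<le> f n u" if "1 \<le> n" for n u
    using that by (induction n rule: dec_induct) (use b incr order_trans in \<open>blast+\<close>)
  then have Eb: "b \<le> E n" if "1 \<le> n" for n
    using that pos(6) \<mu>(1)[of n] by (simp add: E_def add_increasing2)
  have "\<rho> * (\<Sum>n=k1..k2. \<mu> n * s n) \<le> (\<Sum>n=k1..k2. E n - E (Suc n))"
    unfolding sum_distrib_left using k by (intro sum_mono decrease) auto
  also have "\<dots> = E k1 - E (Suc k2)"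
    using sum_Suc_diff[of k1 k2 "\<lambda>n. - E n"] k by simp
  also have "\<dots> \<le> E 1 - b"
    using E1[OF k(1)] Eb[of "Suc k2"] by simp
  finally show ?thesis
    by (simp add: \<rho>_def E_def)
qed

lemma Min_le_sqrt_weighted_sum:
  fixes s \<mu> :: "nat \<Rightarrow> real"
  assumes "k1 \<le> k2" "\<And>n. n \<in> {k1..k2} \<Longrightarrow> 0 < \<mu> n" "\<And>n. 0 \<le> s n"
    and "(\<Sum>n=k1..k2. \<mu> n * (s n)\<^sup>2) \<le> X"
  shows "Min (s ` {k1..k2}) \<le> sqrt (X / (\<Sum>n=k1..k2. \<mu> n))"
proof -
  define m where "m = Min (s ` {k1..k2})"
  have m: "m \<le> s n" if "n \<in> {k1..k2}" for n
    using that by (simp add: m_def)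
  have "m \<in> s ` {k1..k2}"
    unfolding m_def using assms(1) by (intro Min_in) auto
  then have "0 \<le> m"
    using assms(3) by auto
  have pos: "0 < (\<Sum>n=k1..k2. \<mu> n)"
    using assms(1,2) by (intro sum_pos) auto
  have "(\<Sum>n=k1..k2. \<mu> n) * m\<^sup>2 \<le> (\<Sum>n=k1..k2. \<mu> n * (s n)\<^sup>2)"
    unfolding sum_distrib_right
    using m assms(2) \<open>0 \<le> m\<close> by (intro sum_mono mult_left_mono power_mono) (auto simp: less_imp_le)
  then have "m\<^sup>2 \<le> X / (\<Sum>n=k1..k2. \<mu> n)"
    using assms(4) pos by (simp add: field_simps)
  then show ?thesis
    unfolding m_def[symmetric] by (rule real_le_rsqrt)
qed

lemma exists_small_of_weighted_sum:
  fixes s \<mu> :: "nat \<Rightarrow> real"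
  assumes "k1 \<le> k2" "\<And>n. n \<in> {k1..k2} \<Longrightarrow> 0 < \<mu> n" "\<And>n. 0 \<le> s n" "0 < e"
    and "(\<Sum>n=k1..k2. \<mu> n * (s n)\<^sup>2) \<le> X" "X / e\<^sup>2 < (\<Sum>n=k1..k2. \<mu> n)"
  obtains n where "k1 \<le> n" "n \<le> k2" "s n < e"
proof -
  have pos: "0 < (\<Sum>n=k1..k2. \<mu> n)"
    using assms(1,2) by (intro sum_pos) auto
  have "Min (s ` {k1..k2}) \<le> sqrt (X / (\<Sum>n=k1..k2. \<mu> n))"
    using assms by (intro Min_le_sqrt_weighted_sum) auto
  also have "\<dots> < sqrt (e\<^sup>2)"
    using assms(4,6) pos by (intro real_sqrt_less_mono) (simp add: field_simps)
  finally have "Min (s ` {k1..k2}) < e"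
    using assms(4) by simp
  then show thesis
    using assms(1) that by (subst (asm) Min_less_iff) auto
qed

lemma liminf_eq_0_of_weighted_sum:
  fixes s \<mu> :: "nat \<Rightarrow> real"
  assumes \<mu>: "\<And>n. n \<ge> 1 \<Longrightarrow> 0 < \<mu> n"
    and div: "filterlim (\<lambda>N. \<Sum>n=1..N. \<mu> n) at_top sequentially"
    and s: "\<And>n. 0 \<le> s n"
    and bound: "\<And>k1 k2. 1 \<le> k1 \<Longrightarrow> k1 \<le> k2 \<Longrightarrow> (\<Sum>n=k1..k2. \<mu> n * (s n)\<^sup>2) \<le> X"
  shows "liminf (\<lambda>n. ereal (s n)) = 0"
proof (rule antisym)
  show "0 \<le> liminf (\<lambda>n. ereal (s n))"
    by (rule Liminf_bounded) (simp add: s)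
  show "liminf (\<lambda>n. ereal (s n)) \<le> 0"
  proof (rule ccontr)
    assume "\<not> ?thesis"
    then obtain e where e: "0 < ereal e" "ereal e < liminf (\<lambda>n. ereal (s n))"
      using ereal_dense2 by (metis not_le)
    then have "\<forall>\<^sub>F n in sequentially. ereal e < ereal (s n)"
      using less_LiminfD by blast
    then obtain k where k: "\<And>n. n \<ge> k \<Longrightarrow> e < s n"
      by (auto simp: eventually_sequentially)
    define k1 where "k1 = max 1 k"
    define T where "T = (\<Sum>n=1..<k1. \<mu> n)"
    have "\<forall>\<^sub>F N in sequentially. X / e\<^sup>2 + T < (\<Sum>n=1..N. \<mu> n)"
      using div by (simp add: filterlim_at_top_dense)
    then obtain N where N: "\<And>n. n \<ge> N \<Longrightarrow> X / e\<^sup>2 + T < (\<Sum>n=1..n. \<mu> n)"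
      by (auto simp: eventually_sequentially)
    define k2 where "k2 = max N k1"
    have "{1..k2} = {1..<k1} \<union> {k1..k2}"
      by (auto simp: k2_def k1_def)
    then have "(\<Sum>n=1..k2. \<mu> n) = T + (\<Sum>n=k1..k2. \<mu> n)"
      unfolding T_def by (subst sum.union_disjoint[symmetric]) auto
    then have "X / e\<^sup>2 < (\<Sum>n=k1..k2. \<mu> n)"
      using N[of k2] by (simp add: k2_def)
    moreover have "1 \<le> k1" "k1 \<le> k2" "\<And>n. n \<in> {k1..k2} \<Longrightarrow> 0 < \<mu> n"
      using \<mu> by (auto simp: k1_def k2_def)
    ultimately obtain n where "k1 \<le> n" "s n < e"
      using exists_small_of_weighted_sum[of k1 k2 \<mu> s e X] bound[of k1 k2] s e(1)
      by (metis ereal_less(2))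
    then show False
      using k[of n] by (simp add: k1_def)
  qed
qed

lemma powr_increment_le:
  fixes x s :: real
  assumes "0 < x" "0 < s" "s \<le> 1"
  shows "(x + 1) powr s - x powr s \<le> s * x powr (s - 1)"
proof -
  have "\<exists>z. x < z \<and> z < x + 1 \<and>
      (x + 1) powr s - x powr s = (x + 1 - x) * (s * z powr (s - 1))"
    using assms(1)
    by (intro MVT2[where f = "\<lambda>z. z powr s" and f' = "\<lambda>z. s * z powr (s - 1)"])
      (auto intro!: derivative_eq_intros)
  then obtain z where "x < z" and z: "(x + 1) powr s - x powr s = s * z powr (s - 1)"
    by auto
  have "z powr (s - 1) \<le> x powr (s - 1)"
    using assms \<open>x < z\<close> by (intro powr_mono2') auto
  then show ?thesis
    using z assms(2) by simp
qed

lemma sum_powr_lower_bound: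
  fixes s :: real
  assumes "1 \<le> k1" "k1 \<le> k2" "0 < s" "s \<le> 1"
  shows "(real (Suc k2) powr s - real k1 powr s) / s \<le> (\<Sum>n=k1..k2. real n powr (s - 1))"
proof -
  have "(real (Suc k2) powr s - real k1 powr s) = (\<Sum>n=k1..k2. real (Suc n) powr s - real n powr s)"
    using assms(2) by (subst sum_Suc_diff) auto
  also have "\<dots> \<le> (\<Sum>n=k1..k2. s * real n powr (s - 1))"
  proof (rule sum_mono)
    fix n assume "n \<in> {k1..k2}"
    then show "real (Suc n) powr s - real n powr s \<le> s * real n powr (s - 1)"
      using powr_increment_le[of "real n" s] assms by (simp add: add.commute)
  qed
  finally show ?thesis
    using assms(3) by (simp add: sum_distrib_left[symmetric] field_simps)
qed

lemma powr_add_le: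
  fixes x y s :: real
  assumes "0 \<le> x" "0 \<le> y" "0 < s" "s \<le> 1"
  shows "(x + y) powr s \<le> x powr s + y powr s"
proof (cases "x + y = 0")
  case False
  then have pos: "0 < x + y"
    using assms by simp
  have "x / (x + y) \<le> (x / (x + y)) powr s" "y / (x + y) \<le> (y / (x + y)) powr s"
    using powr_mono'[of s 1 "x / (x + y)"] powr_mono'[of s 1 "y / (x + y)"] assms pos
    by (simp_all add: divide_simps)
  then have "1 \<le> (x / (x + y)) powr s + (y / (x + y)) powr s"
    using pos by (metis add_divide_distrib add_mono divide_self less_irrefl)
  also have "\<dots> = (x powr s + y powr s) / (x + y) powr s"
    using assms pos by (simp add: powr_divide add_divide_distrib)
  finally show ?thesis
    using pos by (simp add: field_simps)
qed (use assms in auto)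

lemma admissible_indices_powr:
  assumes "0 < \<tau>" "\<tau> \<le> 1 / (2 * \<eta>)" "1 < \<alpha>"
    and \<mu>: "\<And>n. n \<ge> 1 \<Longrightarrow> \<mu> n = \<tau> * real n powr (- 1 / \<alpha>)"
  shows "admissible_indices \<eta> \<mu>"
  unfolding admissible_indices_def
proof (intro conjI allI impI)
  fix n :: nat assume n: "1 \<le> n"
  show "0 < \<mu> n"
    using n assms by simp
  have "real n powr (- 1 / \<alpha>) \<le> real n powr 0"
    using n assms by (intro powr_mono) auto
  then have "\<tau> * real n powr (- 1 / \<alpha>) \<le> \<tau> * 1"
    using n assms(1) by (intro mult_left_mono) auto
  then show "\<mu> n \<le> 1 / (2 * \<eta>)"
    using n assms(2) by (simp add: \<mu>)
  have "real (Suc n) powr (- 1 / \<alpha>) \<le> real n powr (- 1 / \<alpha>)"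
    using n assms(3) by (intro powr_mono2') auto
  then show "\<mu> (Suc n) \<le> \<mu> n"
    using n assms(1) by (simp add: \<mu>)
next
  have "(\<lambda>n. \<tau> * real n powr (- 1 / \<alpha>)) \<longlonglongrightarrow> \<tau> * 0"
    using assms(3) by (intro tendsto_intros tendsto_neg_powr filterlim_real_sequentially) auto
  then have "(\<lambda>n. \<tau> * real n powr (- 1 / \<alpha>)) \<longlonglongrightarrow> 0"
    by simp
  moreover have "\<forall>\<^sub>F n in sequentially. \<tau> * real n powr (- 1 / \<alpha>) = \<mu> n"
    using eventually_ge_at_top[of 1] by eventually_elim (simp add: \<mu>)
  ultimately show "\<mu> \<longlonglongrightarrow> 0"
    by (rule Lim_transform_eventually)
next
  define s where "s = 1 - 1 / \<alpha>"
  have s: "0 < s" "s \<le> 1" "s - 1 = - 1 / \<alpha>"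
    using assms(3) by (auto simp: s_def)
  have "filterlim (\<lambda>N. \<tau> * ((real (Suc N) powr s - real 1 powr s) / s)) at_top sequentially"
    using s(1) assms(1) by real_asymp
  moreover have "\<forall>\<^sub>F N in sequentially. \<tau> * ((real (Suc N) powr s - real 1 powr s) / s)
      \<le> (\<Sum>n=1..N. \<mu> n)"
    using eventually_ge_at_top[of 1]
  proof eventually_elim
    case (elim N)
    have "(\<Sum>n=1..N. \<mu> n) = \<tau> * (\<Sum>n=1..N. real n powr (s - 1))"
      unfolding sum_distrib_left s(3) by (intro sum.cong) (auto simp: \<mu>)
    then show ?case
      using mult_left_mono[OF sum_powr_lower_bound[OF _ elim s(1,2)], of \<tau>] assms(1) by simp
  qed
  ultimately show "filterlim (\<lambda>N. \<Sum>n=1..N. \<mu> n) at_top sequentially"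
    by (rule filterlim_at_top_mono)
qed

lemma powr_indices_complexity:
  fixes \<mu> :: "nat \<Rightarrow> real"
  assumes "0 < \<tau>" "1 < \<alpha>" and \<epsilon>: "0 < \<epsilon>" "\<epsilon> < 1" and X: "0 < X"
    and \<mu>: "\<And>n. n \<ge> 1 \<Longrightarrow> \<mu> n = \<tau> * real n powr (- 1 / \<alpha>)"
  obtains k1 k2 where "1 \<le> k1" "k1 \<le> k2" "\<And>n. k1 \<le> n \<Longrightarrow> \<mu> n < \<epsilon>"
    "X / \<epsilon>\<^sup>2 < (\<Sum>n=k1..k2. \<mu> n)"
    "int k2 = \<lceil>(X / \<tau> * (1 - 1 / \<alpha>) + \<tau> powr (\<alpha> - 1) + 2) powr (\<alpha> / (\<alpha> - 1))
      * \<epsilon> powr min (- 2 * \<alpha> / (\<alpha> - 1)) (- \<alpha>)\<rceil>"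
proof -
  define s where "s = 1 - 1 / \<alpha>"
  have s: "0 < s" "s \<le> 1" "s - 1 = - 1 / \<alpha>" "\<alpha> * s = \<alpha> - 1" "\<alpha> / (\<alpha> - 1) = 1 / s"
    using assms(2) by (auto simp: s_def field_simps)
  define A where "A = X / \<tau> * s + \<tau> powr (\<alpha> - 1) + 2"
  define q where "q = (\<tau> / \<epsilon>) powr \<alpha>"
  define k1 where "k1 = Suc (nat \<lfloor>q\<rfloor>)"
  define R where "R = A powr (1 / s) * \<epsilon> powr min (- 2 / s) (- \<alpha>)"
  define k2 where "k2 = nat \<lceil>R\<rceil>"
  have "0 \<le> q"
    by (simp add: q_def)
  then have k1: "q < real k1" "real k1 \<le> q + 1"
    unfolding k1_def by linarith+
  have "0 \<le> X / \<tau> * s"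
    using X assms(1) s(1) by simp
  then have A: "0 < A"
    using powr_ge_zero[of \<tau> "\<alpha> - 1"] unfolding A_def by linarith
  have R: "0 \<le> R"
    by (simp add: R_def)
  have small: "\<mu> n < \<epsilon>" if n: "k1 \<le> n" for n
  proof -
    have "q < real n"
      using k1(1) n by simp
    then have "q powr (1 / \<alpha>) < real n powr (1 / \<alpha>)"
      using \<open>0 \<le> q\<close> assms(2) by (intro powr_less_mono2) auto
    moreover have "q powr (1 / \<alpha>) = \<tau> / \<epsilon>"
      using assms \<epsilon> by (simp add: q_def powr_powr)
    ultimately have "\<tau> / real n powr (1 / \<alpha>) < \<epsilon>"
      using \<epsilon> assms(1) \<open>q < real n\<close> \<open>0 \<le> q\<close> by (simp add: field_simps)
    moreover have "n \<ge> 1"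
      using n by (simp add: k1_def)
    ultimately show ?thesis
      by (simp add: \<mu> powr_minus divide_inverse)
  qed
  have "real k1 powr s \<le> (q + 1) powr s"
    using k1(2) s(1) by (intro powr_mono2) auto
  also have "\<dots> \<le> q powr s + 1"
    using powr_add_le[of q 1 s] \<open>0 \<le> q\<close> s by simp
  also have "q powr s = (\<tau> / \<epsilon>) powr (\<alpha> - 1)"
    by (simp add: q_def powr_powr s(4))
  also have "\<dots> = \<tau> powr (\<alpha> - 1) / \<epsilon> powr (\<alpha> - 1)"
    using assms(1) \<epsilon> by (simp add: powr_divide)
  also have "\<dots> = \<tau> powr (\<alpha> - 1) * \<epsilon> powr (- (\<alpha> - 1))"
    by (simp only: powr_minus divide_inverse)
  finally have k1s: "real k1 powr s \<le> \<tau> powr (\<alpha> - 1) * \<epsilon> powr (- (\<alpha> - 1)) + 1" .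
  define m where "m = \<epsilon> powr min (- 2) (- (\<alpha> - 1))"
  have m: "1 / \<epsilon>\<^sup>2 \<le> m" "\<epsilon> powr (- (\<alpha> - 1)) \<le> m" "1 \<le> m"
  proof -
    have "\<epsilon> powr t \<le> m" if "min (- 2) (- (\<alpha> - 1)) \<le> t" for t
      unfolding m_def using \<epsilon> that by (intro powr_mono') auto
    from this[of "- 2"] this[of "- (\<alpha> - 1)"] this[of 0]
    have "\<epsilon> powr (- 2) \<le> m" "\<epsilon> powr (- (\<alpha> - 1)) \<le> m" "\<epsilon> powr 0 \<le> m"
      by auto
    then show "1 / \<epsilon>\<^sup>2 \<le> m" "\<epsilon> powr (- (\<alpha> - 1)) \<le> m" "1 \<le> m"
      using \<epsilon> by (auto simp: powr_minus powr_numeral divide_inverse)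
  qed
  have "min (- 2 / s) (- \<alpha>) * s = min (- 2) (- (\<alpha> - 1))"
    using s(1) by (simp add: min_mult_distrib_right s(4))
  then have "R powr s = A * m"
    using A s(1) \<epsilon> by (simp add: R_def m_def powr_mult powr_powr)
  moreover have "R powr s \<le> real k2 powr s"
    using R s(1) by (intro powr_mono2) (auto simp: k2_def)
  moreover have "X / \<tau> * s * (1 / \<epsilon>\<^sup>2) + \<tau> powr (\<alpha> - 1) * \<epsilon> powr (- (\<alpha> - 1)) + 2 * 1
      \<le> X / \<tau> * s * m + \<tau> powr (\<alpha> - 1) * m + 2 * m"
    using m X assms(1) s(1) by (intro add_mono mult_left_mono) auto
  ultimately have k2s: "X / \<tau> * s * (1 / \<epsilon>\<^sup>2) + real k1 powr s + 1 \<le> real k2 powr s"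
    using k1s by (simp add: A_def algebra_simps)
  moreover have "0 \<le> X / \<tau> * s * (1 / \<epsilon>\<^sup>2)"
    using X assms(1) s(1) by simp
  ultimately have "real k1 powr s < real k2 powr s"
    by linarith
  then have "k1 \<le> k2"
    using s(1) by (metis linear of_nat_0_le_iff of_nat_mono powr_mono2 less_imp_le not_le)
  have "real k2 powr s \<le> real (Suc k2) powr s"
    using s(1) by (intro powr_mono2) auto
  then have "X / \<tau> * s * (1 / \<epsilon>\<^sup>2) < real (Suc k2) powr s - real k1 powr s"
    using k2s by linarith
  then have "X / \<epsilon>\<^sup>2 < \<tau> * ((real (Suc k2) powr s - real k1 powr s) / s)"
    using assms(1) s(1) \<epsilon> by (simp add: field_simps)
  also have "\<dots> \<le> \<tau> * (\<Sum>n=k1..k2. real n powr (s - 1))"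
    using assms(1) by (intro mult_left_mono sum_powr_lower_bound \<open>k1 \<le> k2\<close> s(1,2)) (auto simp: k1_def)
  also have "\<dots> = (\<Sum>n=k1..k2. \<mu> n)"
    unfolding sum_distrib_left s(3) by (intro sum.cong) (auto simp: \<mu> k1_def)
  finally have sum: "X / \<epsilon>\<^sup>2 < (\<Sum>n=k1..k2. \<mu> n)" .
  have "- 2 * \<alpha> / (\<alpha> - 1) = - 2 / s"
    using s(5) by (metis times_divide_eq_right mult.right_neutral)
  then have "R = (X / \<tau> * (1 - 1 / \<alpha>) + \<tau> powr (\<alpha> - 1) + 2) powr (\<alpha> / (\<alpha> - 1))
      * \<epsilon> powr min (- 2 * \<alpha> / (\<alpha> - 1)) (- \<alpha>)"
    by (simp only: R_def A_def s_def[symmetric] s(5))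
  moreover have "int k2 = \<lceil>R\<rceil>"
    using R by (simp add: k2_def)
  ultimately have "int k2 = \<lceil>(X / \<tau> * (1 - 1 / \<alpha>) + \<tau> powr (\<alpha> - 1) + 2) powr (\<alpha> / (\<alpha> - 1))
      * \<epsilon> powr min (- 2 * \<alpha> / (\<alpha> - 1)) (- \<alpha>)\<rceil>"
    by simp
  with \<open>k1 \<le> k2\<close> small sum show thesis
    by (intro that[of k1 k2]) (auto simp: k1_def)
qed

theorem theorem4p9:
  fixes C :: "'x::euclidean_space set"
    and h :: "'x \<Rightarrow> real"
    and S :: "'x \<Rightarrow> 'z::euclidean_space"
    and g :: "'z \<Rightarrow> real"
    and \<phi> :: "'y::euclidean_space \<Rightarrow> 'x"
    and F :: "'x \<Rightarrow> real" and Fn :: "nat \<Rightarrow> 'x \<Rightarrow> real"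
    and y :: "nat \<Rightarrow> 'y" and \<mu> \<gamma> :: "nat \<Rightarrow> real"
    and Lh Lg \<eta> c varpi1 varpi2 \<beta> chi :: real and d :: nat
  assumes C: "C \<noteq> {}" "connected C" "closed C" "embedded_submanifold d C"
    and F_def: "F = (\<lambda>x. h x + g (S x))"
    and h: "h continuously_differentiable_on UNIV" "Lh > 0" "Lh-lipschitz_on C (gradient h)"
    and S: "S continuously_differentiable_on UNIV"
    and g: "Lg > 0" "Lg-lipschitz_on UNIV g" "\<eta> > 0" "weakly_convex \<eta> g"
    and F_bdd: "bdd_below (F ` C)"
    and phi: "\<phi> continuously_differentiable_on UNIV" "range \<phi> = C"
    and c: "0 < c" "c < 1"
    and Fn_def: "Fn = (\<lambda>n. smoothed h S g (\<mu> n))"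
    and A: "varpi1 \<ge> 0" "varpi2 > 0"
      "\<forall>n\<ge>1. (varpi1 + varpi2 / \<mu> n)-lipschitz_on UNIV (gradient (Fn n \<circ> \<phi>))"
    and B: "\<forall>n\<ge>1. y (Suc n) = y n - \<gamma> n *\<^sub>R gradient (Fn n \<circ> \<phi>) (y n)"
      "\<forall>n\<ge>1. \<gamma> n > 0"
      "\<beta> > 0" "\<forall>n\<ge>1. \<gamma> n \<ge> \<beta> / (varpi1 + varpi2 / \<mu> n)"
      "\<forall>n\<ge>1. (Fn n \<circ> \<phi>) (y n - \<gamma> n *\<^sub>R gradient (Fn n \<circ> \<phi>) (y n))
          \<le> (Fn n \<circ> \<phi>) (y n) - c * \<gamma> n * (norm (gradient (Fn n \<circ> \<phi>) (y n)))\<^sup>2"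
    and chi_def: "chi = ((Fn 1 \<circ> \<phi>) (y 1) - (INF u. (Fn 1 \<circ> \<phi>) u) + Lg\<^sup>2 * \<mu> 1)
                          * (varpi1 + \<eta> * varpi2) / (c * \<beta> * \<eta>)"
  shows
    "(admissible_indices \<eta> \<mu> \<longrightarrow>
       \<comment> \<open>(a)\<close>
       (bdd_below (range (Fn 1 \<circ> \<phi>)) \<and> chi > 0 \<and>
        (\<forall>k1 k2. 1 \<le> k1 \<and> k1 \<le> k2 \<longrightarrow>
          Min ((\<lambda>n. norm (gradient (Fn n \<circ> \<phi>) (y n))) ` {k1..k2})
            \<le> sqrt (chi / (\<Sum>n=k1..k2. \<mu> n)))) \<and>
       \<comment> \<open>(b)\<close>
       liminf (\<lambda>n. ereal (norm (gradient (Fn n \<circ> \<phi>) (y n)))) = 0 \<and>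
       \<comment> \<open>(c)\<close>
       (\<forall>m :: nat \<Rightarrow> nat.
          (\<forall>l\<ge>1. m l \<ge> 1) \<and> strict_mono_on {1..} m \<and>
          (\<lambda>l. norm (gradient (Fn (m l) \<circ> \<phi>) (y (m l)))) \<longlonglongrightarrow> 0 \<longrightarrow>
          (\<forall>ystar. cluster_point (y \<circ> m) ystar \<longrightarrow>
             0 \<in> limiting_subdiff (\<lambda>u. ereal ((F \<circ> \<phi>) u)) ystar \<and>
             ({v. adjoint (frechet_derivative \<phi> (at ystar)) v = 0} \<subseteq> normal_cone C (\<phi> ystar) \<longrightarrow>
                0 \<in> limiting_subdiff (\<lambda>x. ereal (F x) + indicator_fun C x) (\<phi> ystar)))))
     \<and>
     \<comment> \<open>(d)\<close>
     (\<forall>\<tau> \<alpha>. 0 < \<tau> \<and> \<tau> \<le> 1 / (2 * \<eta>) \<and> \<alpha> > 1 \<and> (\<forall>n\<ge>1. \<mu> n = \<tau> * real n powr (- 1 / \<alpha>)) \<longrightarrow>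
        admissible_indices \<eta> \<mu> \<and>
        (\<forall>\<epsilon>. 0 < \<epsilon> \<and> \<epsilon> < 1 \<longrightarrow>
          (\<exists>n\<ge>1. int n \<le> \<lceil>(chi / \<tau> * (1 - 1 / \<alpha>) + \<tau> powr (\<alpha> - 1) + 2) powr (\<alpha> / (\<alpha> - 1))
                              * \<epsilon> powr min (- 2 * \<alpha> / (\<alpha> - 1)) (- \<alpha>)\<rceil> \<and>
             norm (gradient (Fn n \<circ> \<phi>) (y n)) < \<epsilon> \<and> \<mu> n < \<epsilon>) \<and>
          (\<forall>n\<ge>1. norm (gradient (Fn n \<circ> \<phi>) (y n)) < \<epsilon> \<and> \<mu> n < \<epsilon> \<longrightarrow>
             approx_stationary_point \<eta> h S g \<phi> \<epsilon> (y n))))"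
proof -
  note wc = g(2) g(4) g(3)
  define G where "G n = gradient (Fn n \<circ> \<phi>) (y n)" for n
  have main: "bdd_below (range (Fn 1 \<circ> \<phi>)) \<and> chi > 0 \<and>
      (\<forall>k1 k2. 1 \<le> k1 \<longrightarrow> k1 \<le> k2 \<longrightarrow> (\<Sum>n=k1..k2. \<mu> n * (norm (G n))\<^sup>2) \<le> chi)"
    if adm: "admissible_indices \<eta> \<mu>"
  proof -
    have \<mu>: "\<And>n. n \<ge> 1 \<Longrightarrow> 0 < \<mu> n" "\<And>n. n \<ge> 1 \<Longrightarrow> \<mu> n \<le> 1 / (2 * \<eta>)"
      "\<And>n. n \<ge> 1 \<Longrightarrow> \<mu> (Suc n) \<le> \<mu> n"
      using adm by (auto simp: admissible_indices_def)
    have \<mu>\<eta>: "\<mu> n \<le> 1 / \<eta>" if "n \<ge> 1" for n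
    proof -
      have "1 / (2 * \<eta>) \<le> 1 / \<eta>"
        using g(3) by (simp add: field_simps)
      then show ?thesis
        using \<mu>(2)[OF that] by simp
    qed
    obtain b where b: "\<And>x. x \<in> C \<Longrightarrow> b \<le> F x"
      using F_bdd by (auto simp: bdd_below_def)
    have "b - Lg\<^sup>2 * \<mu> 1 / 2 \<le> (Fn 1 \<circ> \<phi>) u" for u
    proof -
      have "b \<le> F (\<phi> u)"
        using b phi(2) by blast
      then show ?thesis
        using moreau_envelope_ge_self[OF g(2) \<mu>(1)[of 1], of "S (\<phi> u)"]
        by (simp add: F_def Fn_def smoothed_def)
    qed
    then have bdd: "bdd_below (range (Fn 1 \<circ> \<phi>))"
      by (auto intro!: bdd_belowI2)
    define I where "I = (INF u. (Fn 1 \<circ> \<phi>) u)"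
    have I: "I \<le> (Fn 1 \<circ> \<phi>) u" for u
      unfolding I_def using bdd by (intro cINF_lower) auto
    define \<rho> where "\<rho> = c * \<beta> * \<eta> / (varpi1 + \<eta> * varpi2)"
    have "varpi1 + \<eta> * varpi2 > 0"
      using A g(3) by (simp add: add_nonneg_pos)
    then have \<rho>: "0 < \<rho>" "chi = ((Fn 1 \<circ> \<phi>) (y 1) - I + Lg\<^sup>2 * \<mu> 1) / \<rho>"
      using c B(3) g(3) by (simp_all add: \<rho>_def chi_def I_def)
    have "0 < Lg\<^sup>2 * \<mu> 1"
      using g(1) \<mu>(1)[of 1] by simp
    then have "0 < chi"
      unfolding \<rho>(2) using \<rho>(1) I[of "y 1"] by (intro divide_pos_pos) auto
    moreover have "(\<Sum>n=k1..k2. \<mu> n * (norm (G n))\<^sup>2) \<le> chi" if k: "1 \<le> k1" "k1 \<le> k2" for k1 k2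
    proof -
      have "\<rho> * (\<Sum>n=k1..k2. \<mu> n * (norm (G n))\<^sup>2) \<le> (Fn 1 \<circ> \<phi>) (y 1) - I + Lg\<^sup>2 * \<mu> 1"
        unfolding \<rho>_def
      proof (rule descent_weighted_sum[where f = "\<lambda>n. Fn n \<circ> \<phi>" and \<gamma> = \<gamma>])
        fix n :: nat assume n: "n \<ge> 1"
        have \<mu>n: "0 < \<mu> n" "0 < \<mu> (Suc n)" "\<mu> (Suc n) \<le> \<mu> n"
          using \<mu> n by auto
        show "(Fn n \<circ> \<phi>) (y (Suc n)) \<le> (Fn n \<circ> \<phi>) (y n) - c * \<gamma> n * (norm (G n))\<^sup>2"
          using B(1) B(5) n by (simp add: G_def)
        show "0 < \<mu> n" "\<mu> n \<le> 1 / \<eta>" "\<beta> / (varpi1 + varpi2 / \<mu> n) \<le> \<gamma> n"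
          using \<mu>(1) \<mu>\<eta> B(4) n by auto
        fix u
        show "(Fn n \<circ> \<phi>) u \<le> (Fn (Suc n) \<circ> \<phi>) u"
          using moreau_envelope_antimono[OF g(2) \<mu>n(2,3)] by (simp add: Fn_def smoothed_def)
        have "Lg\<^sup>2 * (\<mu> n - \<mu> (Suc n)) / 2 \<le> Lg\<^sup>2 * (\<mu> n - \<mu> (Suc n))"
          using \<mu>n by simp
        then show "(Fn (Suc n) \<circ> \<phi>) u \<le> (Fn n \<circ> \<phi>) u + Lg\<^sup>2 * (\<mu> n - \<mu> (Suc n))"
          using moreau_envelope_index_diff[OF g(2) \<mu>n(2,3), of "S (\<phi> u)"]
          by (simp add: Fn_def smoothed_def)
      qed (use c B(3) g(3) A I k in auto)
      then show ?thesis
        unfolding \<rho>(2) using \<rho>(1) by (simp add: field_simps)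
    qed
    ultimately show ?thesis
      using bdd by blast
  qed
  have parts: "(bdd_below (range (Fn 1 \<circ> \<phi>)) \<and> chi > 0 \<and>
        (\<forall>k1 k2. 1 \<le> k1 \<and> k1 \<le> k2 \<longrightarrow>
          Min ((\<lambda>n. norm (gradient (Fn n \<circ> \<phi>) (y n))) ` {k1..k2})
            \<le> sqrt (chi / (\<Sum>n=k1..k2. \<mu> n)))) \<and>
       liminf (\<lambda>n. ereal (norm (gradient (Fn n \<circ> \<phi>) (y n)))) = 0 \<and>
       (\<forall>m :: nat \<Rightarrow> nat.
          (\<forall>l\<ge>1. m l \<ge> 1) \<and> strict_mono_on {1..} m \<and>
          (\<lambda>l. norm (gradient (Fn (m l) \<circ> \<phi>) (y (m l)))) \<longlonglongrightarrow> 0 \<longrightarrow>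
          (\<forall>ystar. cluster_point (y \<circ> m) ystar \<longrightarrow>
             0 \<in> limiting_subdiff (\<lambda>u. ereal ((F \<circ> \<phi>) u)) ystar \<and>
             ({v. adjoint (frechet_derivative \<phi> (at ystar)) v = 0} \<subseteq> normal_cone C (\<phi> ystar) \<longrightarrow>
                0 \<in> limiting_subdiff (\<lambda>x. ereal (F x) + indicator_fun C x) (\<phi> ystar))))"
    if adm: "admissible_indices \<eta> \<mu>"
  proof (intro conjI allI impI; (elim conjE)?)
    have \<mu>: "\<And>n. n \<ge> 1 \<Longrightarrow> 0 < \<mu> n" "\<And>n. n \<ge> 1 \<Longrightarrow> \<mu> n \<le> 1 / (2 * \<eta>)" "\<mu> \<longlonglongrightarrow> 0"
      and div: "filterlim (\<lambda>N. \<Sum>n=1..N. \<mu> n) at_top sequentially"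
      using adm by (auto simp: admissible_indices_def)
    note bound = main[OF adm]
    show "bdd_below (range (Fn 1 \<circ> \<phi>))"
      using bound by (rule conjunct1)
    show "0 < chi"
      using bound by simp
    show "Min ((\<lambda>n. norm (gradient (Fn n \<circ> \<phi>) (y n))) ` {k1..k2})
        \<le> sqrt (chi / (\<Sum>n=k1..k2. \<mu> n))" if "1 \<le> k1" "k1 \<le> k2" for k1 k2
      using that bound unfolding G_def[symmetric]
      by (intro Min_le_sqrt_weighted_sum \<mu>) auto
    show "liminf (\<lambda>n. ereal (norm (gradient (Fn n \<circ> \<phi>) (y n)))) = 0"
      unfolding G_def[symmetric] using bound
      by (intro liminf_eq_0_of_weighted_sum[OF \<mu>(1) div, of _ chi]) auto
    fix m :: "nat \<Rightarrow> nat" and u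
    assume m: "\<forall>l\<ge>1. 1 \<le> m l" "strict_mono_on {1..} m"
      and lim: "(\<lambda>l. norm (gradient (Fn (m l) \<circ> \<phi>) (y (m l)))) \<longlonglongrightarrow> 0"
      and "cluster_point (y \<circ> m) u"
    then obtain r where r: "strict_mono r" and ry: "(y \<circ> m \<circ> r) \<longlonglongrightarrow> u"
      unfolding cluster_point_def by blast
    define \<sigma> where "\<sigma> j = m (r (Suc j))" for j
    have r1: "1 \<le> r (Suc j)" for j
      using seq_suble[OF r, of "Suc j"] by simp
    have rSuc: "strict_mono (\<lambda>j. r (Suc j))"
      using r by (simp add: strict_mono_def)
    have \<sigma>1: "1 \<le> \<sigma> j" for j
      using m(1) r1 by (simp add: \<sigma>_def)
    have \<sigma>: "strict_mono \<sigma>"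
      unfolding strict_mono_def \<sigma>_def
      using strict_mono_onD[OF m(2)] r1 rSuc by (auto simp: strict_mono_def)
    have Y: "(\<lambda>j. y (\<sigma> j)) \<longlonglongrightarrow> u"
      using LIMSEQ_Suc[OF ry] by (simp add: \<sigma>_def comp_def)
    have \<nu>: "(\<lambda>j. \<mu> (\<sigma> j)) \<longlonglongrightarrow> 0"
      using LIMSEQ_subseq_LIMSEQ[OF \<mu>(3) \<sigma>] by (simp add: comp_def)
    have "(\<lambda>j. norm (gradient (Fn (\<sigma> j) \<circ> \<phi>) (y (\<sigma> j)))) \<longlonglongrightarrow> 0"
      using LIMSEQ_subseq_LIMSEQ[OF lim rSuc] by (simp add: \<sigma>_def comp_def)
    then have grad: "(\<lambda>j. gradient (smoothed h S g (\<mu> (\<sigma> j)) \<circ> \<phi>) (y (\<sigma> j))) \<longlonglongrightarrow> 0"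
      unfolding Fn_def by (rule tendsto_norm_zero_cancel)
    have "\<phi> u \<in> C"
      using phi(2) by blast
    note stat = smoothed_limit_stationary[where \<nu> = "\<lambda>j. \<mu> (\<sigma> j)" and Y = "\<lambda>j. y (\<sigma> j)",
        OF C(4) this wc h(1) S phi(1) \<mu>(1)[OF \<sigma>1] \<mu>(2)[OF \<sigma>1] \<nu> Y grad]
    show "0 \<in> limiting_subdiff (\<lambda>u. ereal ((F \<circ> \<phi>) u)) u"
      using stat(1) by (simp add: F_def)
    show "0 \<in> limiting_subdiff (\<lambda>x. ereal (F x) + indicator_fun C x) (\<phi> u)"
      if "{v. adjoint (frechet_derivative \<phi> (at u)) v = 0} \<subseteq> normal_cone C (\<phi> u)"
      using stat(2)[OF that] by (simp add: F_def)
  qed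
  have "admissible_indices \<eta> \<mu> \<and>
        (\<forall>\<epsilon>. 0 < \<epsilon> \<and> \<epsilon> < 1 \<longrightarrow>
          (\<exists>n\<ge>1. int n \<le> \<lceil>(chi / \<tau> * (1 - 1 / \<alpha>) + \<tau> powr (\<alpha> - 1) + 2) powr (\<alpha> / (\<alpha> - 1))
                              * \<epsilon> powr min (- 2 * \<alpha> / (\<alpha> - 1)) (- \<alpha>)\<rceil> \<and>
             norm (gradient (Fn n \<circ> \<phi>) (y n)) < \<epsilon> \<and> \<mu> n < \<epsilon>) \<and>
          (\<forall>n\<ge>1. norm (gradient (Fn n \<circ> \<phi>) (y n)) < \<epsilon> \<and> \<mu> n < \<epsilon> \<longrightarrow>
             approx_stationary_point \<eta> h S g \<phi> \<epsilon> (y n)))"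
    if \<tau>: "0 < \<tau>" "\<tau> \<le> 1 / (2 * \<eta>)" and \<alpha>: "\<alpha> > 1"
      and \<mu>_eq: "\<forall>n\<ge>1. \<mu> n = \<tau> * real n powr (- 1 / \<alpha>)" for \<tau> \<alpha>
  proof -
    have adm: "admissible_indices \<eta> \<mu>"
      using admissible_indices_powr[OF \<tau> \<alpha>] \<mu>_eq by blast
    have \<mu>: "\<And>n. n \<ge> 1 \<Longrightarrow> 0 < \<mu> n" "\<And>n. n \<ge> 1 \<Longrightarrow> \<mu> n \<le> 1 / (2 * \<eta>)"
      using adm by (auto simp: admissible_indices_def)
    note bound = main[OF adm]
    have approx: "approx_stationary_point \<eta> h S g \<phi> \<epsilon> (y n)"
      if n: "n \<ge> 1" "norm (gradient (Fn n \<circ> \<phi>) (y n)) < \<epsilon>" "\<mu> n < \<epsilon>" for n \<epsilon>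
    proof -
      have "1 / (2 * \<eta>) < 1 / \<eta>"
        using g(3) by (simp add: field_simps)
      then show ?thesis
        unfolding approx_stationary_point_def using n \<mu>[OF n(1)]
        by (intro exI[of _ "\<mu> n"]) (auto simp: Fn_def)
    qed
    have "\<exists>n\<ge>1. int n \<le> \<lceil>(chi / \<tau> * (1 - 1 / \<alpha>) + \<tau> powr (\<alpha> - 1) + 2) powr (\<alpha> / (\<alpha> - 1))
          * \<epsilon> powr min (- 2 * \<alpha> / (\<alpha> - 1)) (- \<alpha>)\<rceil> \<and>
        norm (gradient (Fn n \<circ> \<phi>) (y n)) < \<epsilon> \<and> \<mu> n < \<epsilon>"
      if \<epsilon>: "0 < \<epsilon>" "\<epsilon> < 1" for \<epsilon>
    proof -
      obtain k1 k2 where k: "1 \<le> k1" "k1 \<le> k2" and small: "\<And>n. k1 \<le> n \<Longrightarrow> \<mu> n < \<epsilon>"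
        and sum: "chi / \<epsilon>\<^sup>2 < (\<Sum>n=k1..k2. \<mu> n)"
        and k2: "int k2 = \<lceil>(chi / \<tau> * (1 - 1 / \<alpha>) + \<tau> powr (\<alpha> - 1) + 2) powr (\<alpha> / (\<alpha> - 1))
          * \<epsilon> powr min (- 2 * \<alpha> / (\<alpha> - 1)) (- \<alpha>)\<rceil>"
      proof (rule powr_indices_complexity[OF \<tau>(1) \<alpha> \<epsilon>, of chi \<mu>])
        show "0 < chi"
          using bound by simp
        show "\<mu> n = \<tau> * real n powr (- 1 / \<alpha>)" if "n \<ge> 1" for n
          using \<mu>_eq that by blast
      qed (rule that)
      have pos: "0 < \<mu> n" if "n \<in> {k1..k2}" for n
        using \<mu>(1) k(1) that by simp
      have "(\<Sum>n=k1..k2. \<mu> n * (norm (G n))\<^sup>2) \<le> chi"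
        using bound k by simp
      then obtain n where "k1 \<le> n" "n \<le> k2" "norm (G n) < \<epsilon>"
        using exists_small_of_weighted_sum[OF k(2) pos norm_ge_zero \<epsilon>(1) _ sum, of G] by blast
      then show ?thesis
        using k small unfolding k2[symmetric] G_def by (intro exI[of _ n]) auto
    qed
    then show ?thesis
      using adm approx by blast
  qed
  then show ?thesis
    using parts by blast
qed

end
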